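(* Let $(G,\tau)$ be an abelian topological group whose group $G^\wedge$ of continuous characters separates the points of $G$ (i.e. $(G,\tau)$ is MAP), and let $\mathcal J:=(G,\tau_{\mathcal K})^\wedge$. The group $(G,\tau_{\mathcal K})$ is $g$-barrelled if and only if $(G^\wedge,\sigma(G^\wedge,G))$ determines $(\mathcal J,\sigma(\mathcal J,G))$.
   Context: All groups are abelian. $\mathbb T$ is the unit circle in $\mathbb C$ and $\mathbb T_+=\{e^{2\pi i t}: t\in[-1/4,1/4]\}$. For a topological group $(G,\tau)$, $G^\wedge=(G,\tau)^\wedge$ is the group of continuous homomorphisms (characters) $G\to\mathbb T$. For a group $L$ of characters of $G$, $\sigma(L,G)$ denotes the topology of pointwise convergence on $L$. $\mathcal K$ is the family of all $\sigma(G^\wedge,G)$-compact subsets of $G^\wedge$, and $\tau_{\mathcal K}$ is the topology on $G$ of uniform convergence on the members of $\mathcal K$; the sets $K^\triangleleft=\{x\in G:\chi(x)\in\mathbb T_+\ \forall\chi\in K\}$, $K\in\mathcal K$, form a basis of neighborhoods of zero. One has $G^\wedge\subseteq\mathcal J\subseteq\mathrm{Hom}(G,\mathbb T)$. A topological group $(G,\mu)$ with $H=(G,\mu)^\wedge$ is $g$-barrelled if every $\sigma(H,G)$-compact subset $S$ of $H$ is equicontinuous with respect to $\mu$, i.e. there is a $\mu$-neighborhood $U$ of zero with $\chi(x)\in\mathbb T_+$ for all $\chi\in S$, $x\in U$. A subgroup $Y$ (with the subspace topology) of a topological group $X$ determines $X$ if the restriction map $X^\wedge\to Y^\wedge$,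 $\chi\mapsto\chi|_Y$, is a topological isomorphism when both dual groups carry the compact-open topology. *)

theory Defs
  imports "HOL-Analysis.Analysis" "HOL-Algebra.Group"
begin

text \<open>
  A group is a HOL-Algebra record, written multiplicatively, so that the zero of an abelian group
  is \<open>\<one>\<^bsub>G\<^esub>\<close>; a topology on it is an element of the type \<open>'a topology\<close> whose
  space is the carrier.  Topological groups are not required to be Hausdorff.
\<close>

definition topological_abelian_group :: "('a, 'b) monoid_scheme \<Rightarrow> 'a topology \<Rightarrow> bool" where
  "topological_abelian_group G T \<longleftrightarrow>
     comm_group G \<and> topspace T = carrier G \<and>
     continuous_map (prod_topology T T) T (\<lambda>(x, y). x \<otimes>\<^bsub>G\<^esub> y) \<and>
     continuous_map T T (\<lambda>x. inv\<^bsub>G\<^esub> x)"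

definition circle_group :: "complex monoid" where
  "circle_group = \<lparr>carrier = sphere 0 1, mult = (*), one = 1\<rparr>"

definition circle_topology :: "complex topology" where
  "circle_topology = top_of_set (sphere 0 1)"

definition T_plus :: "complex set" where
  "T_plus = (\<lambda>t. exp (2 * of_real pi * \<i> * of_real t)) ` {- 1 / 4 .. 1 / 4 :: real}"

text \<open>
  Characters are extensional, i.e. \<open>undefined\<close> outside the carrier, so that equality of
  characters is equality of functions on the group.
\<close>

definition characters :: "('a, 'b) monoid_scheme \<Rightarrow> 'a topology \<Rightarrow> ('a \<Rightarrow> complex) set" where
  "characters G T =
     {\<phi> \<in> hom G circle_group \<inter> extensional (carrier G). continuous_map T circle_topology \<phi>}"

definition dual_group :: "('a, 'b) monoid_scheme \<Rightarrow> 'a topology \<Rightarrow> ('a \<Rightarrow> complex) monoid" where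
  "dual_group G T =
     \<lparr>carrier = characters G T,
      mult = (\<lambda>\<phi> \<psi>. \<lambda>x\<in>carrier G. \<phi> x * \<psi> x),
      one = (\<lambda>x\<in>carrier G. 1)\<rparr>"

definition separates_points :: "('a, 'b) monoid_scheme \<Rightarrow> ('a \<Rightarrow> complex) set \<Rightarrow> bool" where
  "separates_points G L \<longleftrightarrow>
     (\<forall>x\<in>carrier G. \<forall>y\<in>carrier G. x \<noteq> y \<longrightarrow> (\<exists>\<phi>\<in>L. \<phi> x \<noteq> \<phi> y))"

text \<open>The topology \<open>\<sigma>(L, G)\<close>, for a set \<open>L\<close> of extensional circle-valued functions on \<open>G\<close>.\<close>

definition pointwise_topology ::
    "('a \<Rightarrow> complex) set \<Rightarrow> ('a, 'b) monoid_scheme \<Rightarrow> ('a \<Rightarrow> complex) topology" where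
  "pointwise_topology L G =
     subtopology (product_topology (\<lambda>_. circle_topology) (carrier G)) L"

definition compact_open_topology ::
    "('a, 'b) monoid_scheme \<Rightarrow> 'a topology \<Rightarrow> ('a \<Rightarrow> complex) topology" where
  "compact_open_topology G T =
     topology_generated_by
       {{\<phi> \<in> characters G T. \<phi> ` C \<subseteq> V} | C V. compactin T C \<and> openin circle_topology V}"

text \<open>
  The family \<open>\<K>\<close>, and the topology \<open>\<tau>\<^sub>\<K>\<close> of uniform convergence on its members.  As \<open>\<K>\<close> is
  closed under finite unions, a single member suffices to describe a basic neighbourhood.
\<close>

definition compact_char_sets ::
    "('a, 'b) monoid_scheme \<Rightarrow> 'a topology \<Rightarrow> ('a \<Rightarrow> complex) set set" where
  "compact_char_sets G T = {K. compactin (pointwise_topology (characters G T) G) K}"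

definition tau_K :: "('a, 'b) monoid_scheme \<Rightarrow> 'a topology \<Rightarrow> 'a topology" where
  "tau_K G T =
     topology (\<lambda>U. U \<subseteq> carrier G \<and>
       (\<forall>x\<in>U. \<exists>K\<in>compact_char_sets G T. \<exists>e>0.
          {y \<in> carrier G. \<forall>\<phi>\<in>K. dist (\<phi> y) (\<phi> x) < e} \<subseteq> U))"

lemma openin_tau_K:
  "openin (tau_K G T) U \<longleftrightarrow>
     U \<subseteq> carrier G \<and>
     (\<forall>x\<in>U. \<exists>K\<in>compact_char_sets G T. \<exists>e>0.
        {y \<in> carrier G. \<forall>\<phi>\<in>K. dist (\<phi> y) (\<phi> x) < e} \<subseteq> U)"
proof -
  define P where "P = (\<lambda>U. U \<subseteq> carrier G \<and>
     (\<forall>x\<in>U. \<exists>K\<in>compact_char_sets G T. \<exists>e>0.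
        {y \<in> carrier G. \<forall>\<phi>\<in>K. dist (\<phi> y) (\<phi> x) < e} \<subseteq> U))"
  have int: "P (A \<inter> B)" if A: "P A" and B: "P B" for A B
    unfolding P_def
  proof (intro conjI ballI)
    show "A \<inter> B \<subseteq> carrier G" using A by (auto simp: P_def)
  next
    fix x assume x: "x \<in> A \<inter> B"
    obtain K d where K: "K \<in> compact_char_sets G T" "d > 0"
        "{y \<in> carrier G. \<forall>\<phi>\<in>K. dist (\<phi> y) (\<phi> x) < d} \<subseteq> A"
      using A x unfolding P_def by blast
    obtain L e where L: "L \<in> compact_char_sets G T" "e > 0"
        "{y \<in> carrier G. \<forall>\<phi>\<in>L. dist (\<phi> y) (\<phi> x) < e} \<subseteq> B"
      using B x unfolding P_def by blast
    have "K \<union> L \<in> compact_char_sets G T"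
      using K(1) L(1) by (simp add: compact_char_sets_def compactin_Un)
    moreover have "min d e > 0" using K(2) L(2) by simp
    moreover have "{y \<in> carrier G. \<forall>\<phi>\<in>K \<union> L. dist (\<phi> y) (\<phi> x) < min d e} \<subseteq> A \<inter> B"
      using K(3) L(3) by auto
    ultimately show "\<exists>K\<in>compact_char_sets G T. \<exists>e>0.
        {y \<in> carrier G. \<forall>\<phi>\<in>K. dist (\<phi> y) (\<phi> x) < e} \<subseteq> A \<inter> B" by blast
  qed
  have un: "P (\<Union>\<A>)" if "\<forall>A\<in>\<A>. P A" for \<A>
    unfolding P_def
  proof (intro conjI ballI)
    show "\<Union>\<A> \<subseteq> carrier G" using that by (auto simp: P_def)
  next
    fix x assume "x \<in> \<Union>\<A>"
    then obtain A where A: "A \<in> \<A>" "x \<in> A" by blast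
    then have "P A" using that by simp
    with A(2) obtain K e where "K \<in> compact_char_sets G T" "e > 0"
        "{y \<in> carrier G. \<forall>\<phi>\<in>K. dist (\<phi> y) (\<phi> x) < e} \<subseteq> A"
      unfolding P_def by blast
    with A show "\<exists>K\<in>compact_char_sets G T. \<exists>e>0.
        {y \<in> carrier G. \<forall>\<phi>\<in>K. dist (\<phi> y) (\<phi> x) < e} \<subseteq> \<Union>\<A>" by blast
  qed
  have "istopology P" using int un unfolding istopology_def by blast
  then have "openin (topology P) U = P U" by (simp add: topology_inverse')
  then show ?thesis unfolding tau_K_def P_def .
qed

definition g_barrelled :: "('a, 'b) monoid_scheme \<Rightarrow> 'a topology \<Rightarrow> bool" where
  "g_barrelled G M \<longleftrightarrow>
     (\<forall>S. compactin (pointwise_topology (characters G M) G) S \<longrightarrow>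
        (\<exists>U. openin M U \<and> \<one>\<^bsub>G\<^esub> \<in> U \<and> (\<forall>\<phi>\<in>S. \<forall>x\<in>U. \<phi> x \<in> T_plus)))"

definition restriction_map ::
    "('a, 'b) monoid_scheme \<Rightarrow> ('a \<Rightarrow> complex) \<Rightarrow> ('a \<Rightarrow> complex)" where
  "restriction_map Y \<phi> = restrict \<phi> (carrier Y)"

text \<open>
  \<open>determines Y TY X TX\<close>: the group \<open>(Y, TY)\<close> determines \<open>(X, TX)\<close>.  The first three
  conjuncts say that \<open>Y\<close> is a subgroup of \<open>X\<close> with the induced operation and topology.
\<close>

definition determines :: "'a monoid \<Rightarrow> 'a topology \<Rightarrow> 'a monoid \<Rightarrow> 'a topology \<Rightarrow> bool" where
  "determines Y TY X TX \<longleftrightarrow>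
     subgroup (carrier Y) X \<and> Y = X\<lparr>carrier := carrier Y\<rparr> \<and> TY = subtopology TX (carrier Y) \<and>
     restriction_map Y \<in> iso (dual_group X TX) (dual_group Y TY) \<and>
     homeomorphic_map (compact_open_topology X TX) (compact_open_topology Y TY) (restriction_map Y)"

end

theory Submission
  imports Defs "HOL-Real_Asymp.Real_Asymp"
begin

text \<open>
  Write \<open>L = G\<^sup>\<and>\<close>.  A continuous character of \<open>(L, \<sigma>(L, G))\<close> or \<open>(\<J>, \<sigma>(\<J>, G))\<close> is evaluation at a point of
  \<open>G\<close> (Comfort and Ross), so restriction identifies both dual groups with \<open>G\<close>.  The compact-open
  topology of the dual of \<open>L\<close> then becomes \<open>\<tau>\<^sub>\<K>\<close>, and that of the dual of \<open>\<J>\<close> becomes uniform convergence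
  on the \<open>\<sigma>(\<J>, G)\<close>-compact subsets of \<open>\<J>\<close>, which is always finer.  The two agree exactly if every such
  compact set is \<open>\<tau>\<^sub>\<K>\<close>-equicontinuous.

  For the Comfort-Ross theorem, a character \<open>\<xi>\<close> of \<open>L\<close> is near \<open>1\<close> wherever finitely many evaluations
  are.  That \<open>\<xi>\<close> is then a monomial in these evaluations follows from the orthogonality of distinct
  characters under finite averages, which replaces the duality theory of closed subgroups of a torus.
\<close>

section \<open>Monomials in circle-valued homomorphisms\<close>

lemma hom_circle_norm: "h \<in> hom G circle_group \<Longrightarrow> x \<in> carrier G \<Longrightarrow> cmod (h x) = 1"
  by (auto simp: hom_def circle_group_def)

lemma hom_circle_nonzero: "h \<in> hom G circle_group \<Longrightarrow> x \<in> carrier G \<Longrightarrow> h x \<noteq> 0"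
  using hom_circle_norm by fastforce

lemma hom_circle_mult:
  "h \<in> hom G circle_group \<Longrightarrow> x \<in> carrier G \<Longrightarrow> y \<in> carrier G \<Longrightarrow> h (x \<otimes>\<^bsub>G\<^esub> y) = h x * h y"
  by (auto simp: hom_def circle_group_def)

context group
begin

lemma hom_circle_one: "h \<in> hom G circle_group \<Longrightarrow> h \<one> = 1"
  using hom_circle_mult[of h G \<one> \<one>] hom_circle_nonzero[of h G \<one>]
  by (metis l_one mult_cancel_right1 one_closed)

lemma hom_circle_inv:
  assumes "h \<in> hom G circle_group" "x \<in> carrier G"
  shows "h (inv x) = inverse (h x)"
proof -
  have "h (inv x) * h x = 1"
    using hom_circle_mult[OF assms(1), of "inv x" x] assms
    by (simp add: hom_circle_one)
  then show ?thesis
    by (metis inverse_unique mult.commute)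
qed

lemma hom_circle_pow:
  "h \<in> hom G circle_group \<Longrightarrow> x \<in> carrier G \<Longrightarrow> h (x [^] (k::nat)) = h x ^ k"
  by (induction k) (simp_all add: hom_circle_mult hom_circle_one)

lemma hom_circle_times:
  "h \<in> hom G circle_group \<Longrightarrow> k \<in> hom G circle_group \<Longrightarrow> (\<lambda>x. h x * k x) \<in> hom G circle_group"
  by (auto simp: hom_def circle_group_def norm_mult dist_norm Pi_iff)

lemma hom_circle_prod_powi:
  assumes "\<And>i. i \<in> F \<Longrightarrow> h i \<in> hom G circle_group"
  shows "(\<lambda>x. \<Prod>i\<in>F. h i x powi k i) \<in> hom G circle_group"
  using assms
proof (induction F rule: infinite_finite_induct)
  case (insert i F)
  have "(\<lambda>x. h i x powi k i) \<in> hom G circle_group"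
    using insert.prems[of i]
    by (auto simp: hom_def circle_group_def Pi_iff norm_power_int power_int_mult_distrib)
  from hom_circle_times[OF this insert.IH] show ?case
    using insert by simp
qed (auto simp: hom_def circle_group_def)

text \<open>Averaging over the cyclic subgroup generated by an element that \<open>\<eta> i\<close> moves makes the
  coefficient of \<open>\<eta> i\<close> negligible and does not affect the bound.\<close>

lemma Re_constant_coefficient_le:
  fixes \<eta> :: "'i \<Rightarrow> 'a \<Rightarrow> complex"
  assumes "finite I"
    and "\<And>i. i \<in> I \<Longrightarrow> \<eta> i \<in> hom G circle_group"
    and "\<And>i. i \<in> I \<Longrightarrow> \<exists>x\<in>carrier G. \<eta> i x \<noteq> 1"
    and "\<And>x. x \<in> carrier G \<Longrightarrow> Re (c\<^sub>0 + (\<Sum>i\<in>I. c i * \<eta> i x)) \<le> B"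
  shows "Re c\<^sub>0 \<le> B"
  using assms
proof (induction I arbitrary: c B rule: finite_induct)
  case empty
  \<comment> \<open>With no terms left, the hypothesis is read off at the unit of the group.\<close>
  then show ?case using one_closed by fastforce
next
  case (insert j I)
  define K where "K = insert j I"
  have hom: "\<And>i. i \<in> K \<Longrightarrow> \<eta> i \<in> hom G circle_group"
    using insert.prems(1) by (simp add: K_def)
  have j: "j \<in> K" by (simp add: K_def)
  obtain g where g: "g \<in> carrier G" "\<eta> j g \<noteq> 1" using insert.prems(2) by blast
  define a where "a i N = (\<Sum>k<N. \<eta> i g ^ k) / of_nat N" for i and N :: nat
  \<comment> \<open>Averaging the hypothesis over the points \<open>x \<otimes> g [^] k\<close> with
    \<open>k < N\<close> turns each coefficient \<open>c i\<close> into \<open>c i * a i N\<close>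
    and keeps \<open>B\<close>. The term of \<open>j\<close> is then moved into the bound, which is
    why the induction leaves both \<open>c\<close> and \<open>B\<close> arbitrary.\<close>
  have bound: "Re c\<^sub>0 \<le> B + cmod (c j) * cmod (a j N)" if N: "N > 0" for N
  proof (rule insert.IH[of "\<lambda>i. c i * a i N"])
    fix x assume x: "x \<in> carrier G"
    have "(\<Sum>k<N. \<Sum>i\<in>K. c i * \<eta> i (x \<otimes> g [^] k)) = (\<Sum>i\<in>K. \<Sum>k<N. c i * \<eta> i (x \<otimes> g [^] k))"
      by (rule sum.swap)
    also have "\<dots> = (\<Sum>i\<in>K. of_nat N * (c i * a i N * \<eta> i x))"
    proof (rule sum.cong[OF refl])
      fix i assume i: "i \<in> K"
      have "(\<Sum>k<N. c i * \<eta> i (x \<otimes> g [^] k)) = (\<Sum>k<N. c i * \<eta> i x * \<eta> i g ^ k)"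
        using x g by (simp add: hom_circle_mult[OF hom[OF i]] hom_circle_pow[OF hom[OF i]] mult.assoc)
      also have "\<dots> = of_nat N * (c i * a i N * \<eta> i x)"
        using N by (simp add: a_def sum_distrib_left[symmetric])
      finally show "(\<Sum>k<N. c i * \<eta> i (x \<otimes> g [^] k)) = of_nat N * (c i * a i N * \<eta> i x)" .
    qed
    finally have "(\<Sum>k<N. c\<^sub>0 + (\<Sum>i\<in>K. c i * \<eta> i (x \<otimes> g [^] k)))
        = of_nat N * (c\<^sub>0 + (\<Sum>i\<in>K. c i * a i N * \<eta> i x))"
      by (simp add: sum.distrib sum_distrib_left[symmetric] distrib_left)
    moreover have "Re (\<Sum>k<N. c\<^sub>0 + (\<Sum>i\<in>K. c i * \<eta> i (x \<otimes> g [^] k))) \<le> real (card {..<N}) * B"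
      unfolding Re_sum
    proof (rule sum_bounded_above)
      fix k :: nat
      have "x \<otimes> g [^] k \<in> carrier G" using x g by simp
      then show "Re (c\<^sub>0 + (\<Sum>i\<in>K. c i * \<eta> i (x \<otimes> g [^] k))) \<le> B"
        unfolding K_def by (rule insert.prems(3))
    qed
    ultimately have "Re (of_nat N * (c\<^sub>0 + (\<Sum>i\<in>K. c i * a i N * \<eta> i x))) \<le> real N * B"
      by (simp only: card_lessThan)
    then have "Re (c\<^sub>0 + (\<Sum>i\<in>K. c i * a i N * \<eta> i x)) \<le> B"
      using N by simp
    moreover have "- Re (c j * a j N * \<eta> j x) \<le> cmod (c j) * cmod (a j N)"
      using abs_Re_le_cmod[of "c j * a j N * \<eta> j x"] hom_circle_norm[OF hom[OF j] x]
      by (simp add: norm_mult del: Re_complex_of_real times_complex.sel)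
    ultimately show "Re (c\<^sub>0 + (\<Sum>i\<in>I. c i * a i N * \<eta> i x)) \<le> B + cmod (c j) * cmod (a j N)"
      using insert.hyps by (simp add: K_def del: times_complex.sel)
  qed (use insert.prems in auto)
  \<comment> \<open>The geometric sum is \<open>(z ^ N - 1) / (z - 1)\<close> with
    \<open>z = \<eta> j g\<close>, and its numerator has norm at most 2.\<close>
  have norm_a: "cmod (a j N) \<le> 2 / cmod (\<eta> j g - 1) / real N" for N
  proof -
    have "cmod (\<eta> j g ^ N - 1) \<le> 2"
      using norm_triangle_ineq4[of "\<eta> j g ^ N" 1] hom_circle_norm[OF hom[OF j] g(1)]
      by (simp add: norm_power)
    then show ?thesis
      using g by (simp add: a_def geometric_sum norm_divide norm_mult divide_right_mono)
  qed
  have "(\<lambda>N. 2 / cmod (\<eta> j g - 1) / real N) \<longlonglongrightarrow> 0"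
    by (rule lim_const_over_n)
  then have "(\<lambda>N. a j N) \<longlonglongrightarrow> 0"
    by (rule Lim_null_comparison[rotated]) (intro always_eventually allI norm_a)
  then have "(\<lambda>N. B + cmod (c j) * cmod (a j N)) \<longlonglongrightarrow> B + cmod (c j) * cmod 0"
    by (intro tendsto_intros)
  then show ?case
    using bound by (intro tendsto_lowerbound[of _ B sequentially])
      (auto simp: eventually_at_top_dense intro!: exI[of _ 0])
qed

text \<open>Indices with a trivial homomorphism contribute constants. Once these are merged into a
  single constant, only nontrivial homomorphisms remain and the previous bound applies. Different
  indices may carry the same homomorphism, hence the sum over all trivial ones.\<close>

lemma Re_trivial_coefficients_le:
  fixes \<eta> :: "'i \<Rightarrow> 'a \<Rightarrow> complex"
  assumes "finite I"
    and hom: "\<And>i. i \<in> I \<Longrightarrow> \<eta> i \<in> hom G circle_group"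
    and bound: "\<And>x. x \<in> carrier G \<Longrightarrow> Re (\<Sum>i\<in>I. c i * \<eta> i x) \<le> B"
  shows "(\<Sum>i\<in>{i\<in>I. \<forall>x\<in>carrier G. \<eta> i x = 1}. Re (c i)) \<le> B"
proof -
  define J where "J = {i\<in>I. \<forall>x\<in>carrier G. \<eta> i x = 1}"
  have "Re (\<Sum>i\<in>J. c i) \<le> B"
  proof (rule Re_constant_coefficient_le[of "I - J" \<eta> _ c])
    fix x assume x: "x \<in> carrier G"
    have "(\<Sum>i\<in>I. c i * \<eta> i x) = (\<Sum>i\<in>J. c i * \<eta> i x) + (\<Sum>i\<in>I - J. c i * \<eta> i x)"
      using assms(1) by (metis (no_types, lifting) J_def add.commute mem_Collect_eq subsetI sum.subset_diff)
    also have "(\<Sum>i\<in>J. c i * \<eta> i x) = (\<Sum>i\<in>J. c i)"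
      using x by (intro sum.cong) (auto simp: J_def)
    finally show "Re ((\<Sum>i\<in>J. c i) + (\<Sum>i\<in>I - J. c i * \<eta> i x)) \<le> B"
      using bound[OF x] by simp
  qed (use assms in \<open>auto simp: J_def\<close>)
  then show ?thesis by (simp add: J_def Re_sum)
qed

end

section \<open>A kernel on the circle that peaks at 1\<close>

lemma unit_dist_1_squared:
  assumes "cmod z = 1"
  shows "(cmod (z - 1))\<^sup>2 = 2 - 2 * Re z"
proof -
  have "(Re z)\<^sup>2 + (Im z)\<^sup>2 = 1"
    using assms by (simp add: cmod_power2[symmetric])
  then show ?thesis
    by (simp add: cmod_power2[of "z - 1"]) (simp add: power2_eq_square algebra_simps)
qed

text \<open>On the unit circle \<open>(1 + Re z) / 2\<close> equals
  \<open>(1 + z)\<^sup>2 / (4 * z)\<close>, and the binomial theorem expands its powers. What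
  matters later is that all coefficients are nonnegative and that the constant one, at
  \<open>k = N\<close>, is the central binomial coefficient over \<open>4 ^ N\<close>.\<close>

lemma unit_Re_power_expansion:
  fixes z :: complex
  assumes "cmod z = 1"
  shows "of_real (((1 + Re z) / 2) ^ N)
    = (\<Sum>k\<le>2 * N. of_real (real (2 * N choose k) / 4 ^ N) * z powi (int k - int N))"
proof -
  have z: "z \<noteq> 0" using assms by auto
  have "z * cnj z = 1" using assms by (simp add: complex_norm_square[symmetric])
  then have "of_real (1 + Re z) * (2 * z) = (1 + z)\<^sup>2"
    by (simp add: complex_eq_iff power2_eq_square algebra_simps)
  moreover have "of_real ((1 + Re z) / 2) * (4 * z) = of_real (1 + Re z) * (2 * z)"
    by (simp add: field_simps)
  ultimately have "of_real ((1 + Re z) / 2) * (4 * z) = (1 + z)\<^sup>2"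
    by (simp only:)
  then have "of_real ((1 + Re z) / 2) = (1 + z)\<^sup>2 / (4 * z)"
    using z by (metis eq_divide_eq mult_eq_0_iff zero_neq_numeral)
  then have "of_real (((1 + Re z) / 2) ^ N) = (z + 1) ^ (2 * N) / (4 * z) ^ N"
    by (simp only: of_real_power) (simp only: power_divide power_mult add.commute)
  also have "\<dots> = (\<Sum>k\<le>2 * N. of_nat (2 * N choose k) * z ^ k / (4 * z) ^ N)"
    by (simp add: binomial_ring sum_divide_distrib)
  also have "\<dots> = (\<Sum>k\<le>2 * N. of_real (real (2 * N choose k) / 4 ^ N) * z powi (int k - int N))"
    using z by (intro sum.cong) (simp_all add: power_int_diff power_mult_distrib)
  finally show ?thesis .
qed

lemma power_times_geometric_tendsto_0:
  fixes q :: real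
  assumes "0 < q" "q < 1"
  shows "(\<lambda>N. real N ^ n * q ^ N) \<longlonglongrightarrow> 0"
  using assms by real_asymp


text \<open>If \<open>\<xi>\<close> were none of the monomials, the mean of
  \<open>F * (1/2 - Re \<xi>)\<close> with the kernel \<open>F = (\<Prod>i. (1 + Re (h i)) / 2) ^ N\<close> would be half the
  mean of \<open>F\<close>, which decays only polynomially in \<open>N\<close>.  But this function is nonpositive where all
  \<open>h i\<close> are close to \<open>1\<close> and exponentially small elsewhere.\<close>

lemma (in group) hom_circle_eq_monomial:
  fixes h :: "'i \<Rightarrow> 'a \<Rightarrow> complex"
  assumes F: "finite F"
    and h: "\<And>i. i \<in> F \<Longrightarrow> h i \<in> hom G circle_group"
    and \<xi>: "\<xi> \<in> hom G circle_group"
    and \<delta>: "\<delta> > 0"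
    and near: "\<And>x. x \<in> carrier G \<Longrightarrow> (\<And>i. i \<in> F \<Longrightarrow> dist (h i x) 1 < \<delta>) \<Longrightarrow> 1 / 2 \<le> Re (\<xi> x)"
  shows "\<exists>k :: 'i \<Rightarrow> int. \<forall>x\<in>carrier G. \<xi> x = (\<Prod>i\<in>F. h i x powi k i)"
proof (rule ccontr)
  assume none: "\<not> ?thesis"
  \<comment> \<open>For unit \<open>z\<close> the number \<open>(1 + Re z) / 2\<close> is
    \<open>1 - (cmod (z - 1))\<^sup>2 / 4\<close>, so \<open>q\<close> bounds every factor of the
    kernel whose argument has distance at least \<open>\<epsilon>\<close> from 1. The cap at 1 keeps
    \<open>q\<close> positive.\<close>
  define \<epsilon> where "\<epsilon> = min \<delta> 1"
  define q where "q = 1 - \<epsilon>\<^sup>2 / 4"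
  have \<epsilon>: "0 < \<epsilon>" "\<epsilon> \<le> 1" "\<epsilon> \<le> \<delta>" using \<delta> by (auto simp: \<epsilon>_def)
  then have q: "0 < q" "q < 1"
    using power_le_one[of \<epsilon> 2] by (auto simp: q_def)
  have norm_h: "cmod (h i x) = 1" if "i \<in> F" "x \<in> carrier G" for i x
    using hom_circle_norm[OF h[OF that(1)] that(2)] .
  define f where "f x = (\<Prod>i\<in>F. (1 + Re (h i x)) / 2)" for x
  have factor: "0 \<le> (1 + Re (h i x)) / 2" "(1 + Re (h i x)) / 2 \<le> 1" if "i \<in> F" "x \<in> carrier G" for i x
    using abs_Re_le_cmod[of "h i x"] norm_h[OF that] by auto
  have f_nonneg: "0 \<le> f x" if "x \<in> carrier G" for x
    unfolding f_def using that factor by (intro prod_nonneg) auto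
  have f_far: "f x \<le> q" if x: "x \<in> carrier G" and i: "i \<in> F" "\<not> dist (h i x) 1 < \<delta>" for x i
  proof -
    have "\<epsilon>\<^sup>2 \<le> (cmod (h i x - 1))\<^sup>2"
      using i(2) \<epsilon> by (intro power_mono) (auto simp: dist_norm)
    also have "\<dots> = 2 - 2 * Re (h i x)"
      by (rule unit_dist_1_squared[OF norm_h[OF i(1) x]])
    finally have *: "(1 + Re (h i x)) / 2 \<le> q" by (simp add: q_def)
    have "f x = (1 + Re (h i x)) / 2 * (\<Prod>j\<in>F - {i}. (1 + Re (h j x)) / 2)"
      unfolding f_def using F i(1) by (rule prod.remove)
    also have "\<dots> \<le> (1 + Re (h i x)) / 2 * 1"
      using x factor i(1) by (intro mult_left_mono prod_le_1) auto
    finally show ?thesis using * by simp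
  qed
  \<comment> \<open>The power \<open>f x ^ N\<close> is multiplied out: a multi-index
    \<open>\<kappa>\<close> in \<open>P N\<close> picks one term from each factor, with weight
    \<open>W N \<kappa>\<close> and monomial \<open>m N \<kappa>\<close>. Exponents are shifted by
    \<open>N\<close>, so the multi-index with all entries \<open>N\<close> gives the monomial
    1.\<close>
  define w where "w N k = real (2 * N choose k) / 4 ^ N" for N k
  define m where "m N \<kappa> x = (\<Prod>i\<in>F. h i x powi (int (\<kappa> i) - int N))" for N :: nat and \<kappa> x
  define P where "P N = (\<Pi>\<^sub>E i\<in>F. {..2 * N})" for N :: nat
  define W where "W N \<kappa> = (\<Prod>i\<in>F. w N (\<kappa> i))" for N :: nat and \<kappa>
  have W_nonneg: "0 \<le> W N \<kappa>" for N \<kappa>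
    by (auto simp: W_def w_def intro!: prod_nonneg)
  have fin_P: "finite (P N)" for N using F by (auto simp: P_def intro: finite_PiE)
  have m_hom: "m N \<kappa> \<in> hom G circle_group" for N \<kappa>
    unfolding m_def by (rule hom_circle_prod_powi[OF h])
  have expansion: "of_real (f x ^ N) = (\<Sum>\<kappa>\<in>P N. of_real (W N \<kappa>) * m N \<kappa> x)" if x: "x \<in> carrier G" for x N
  proof -
    have "(of_real (f x ^ N) :: complex) = (\<Prod>i\<in>F. of_real (((1 + Re (h i x)) / 2) ^ N))"
      by (simp add: f_def prod_power_distrib)
    also have "\<dots> = (\<Prod>i\<in>F. \<Sum>k\<le>2 * N. of_real (w N k) * h i x powi (int k - int N))"
      using norm_h x by (intro prod.cong refl) (simp only: unit_Re_power_expansion w_def)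
    also have "\<dots> = (\<Sum>\<kappa>\<in>P N. \<Prod>i\<in>F. of_real (w N (\<kappa> i)) * h i x powi (int (\<kappa> i) - int N))"
      unfolding P_def using F by (intro prod_sum_PiE) auto
    also have "\<dots> = (\<Sum>\<kappa>\<in>P N. of_real (W N \<kappa>) * m N \<kappa> x)"
      by (simp add: W_def m_def prod.distrib)
    finally show ?thesis .
  qed
  \<comment> \<open>Otherwise \<xi> would be the inverse of a monomial, hence a monomial. So the
    products with \<xi>, which enter below with negative weight, add nothing to the constant
    coefficient.\<close>
  have nontrivial: "\<exists>x\<in>carrier G. \<xi> x * m N \<kappa> x \<noteq> 1" for N \<kappa>
  proof (rule ccontr)
    assume *: "\<not> ?thesis"
    have "\<xi> x = (\<Prod>i\<in>F. h i x powi (int N - int (\<kappa> i)))" if x: "x \<in> carrier G" for x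
    proof -
      have "m N \<kappa> x * (\<Prod>i\<in>F. h i x powi (int N - int (\<kappa> i))) = 1"
        unfolding m_def prod.distrib[symmetric]
        using hom_circle_nonzero[OF h x]
        by (intro prod.neutral ballI) (simp add: power_int_add[symmetric])
      moreover have "\<xi> x * m N \<kappa> x = 1" using * x by blast
      ultimately show ?thesis by (metis mult.assoc mult.commute mult.right_neutral)
    qed
    then have "\<forall>x\<in>carrier G. \<xi> x = (\<Prod>i\<in>F. h i x powi (int N - int (\<kappa> i)))" ..
    then have "\<exists>k. \<forall>x\<in>carrier G. \<xi> x = (\<Prod>i\<in>F. h i x powi k i)"
      by (rule exI[where x = "\<lambda>i. int N - int (\<kappa> i)"])
    with none show False ..
  qed
  have bound: "W N (\<lambda>i\<in>F. N) / 2 \<le> 3 / 2 * q ^ N" for N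
  proof -
    \<comment> \<open>The Boolean separates the two halves of
      \<open>(1 / 2 - \<xi> x) * of_real (f x ^ N)\<close>: \<open>True\<close> marks the terms of
      half the kernel, \<open>False\<close> those of the kernel times
      \<open>- \<xi>\<close>.\<close>
    define \<eta> where "\<eta> = (\<lambda>(\<kappa>, b) x. if b then m N \<kappa> x else \<xi> x * m N \<kappa> x)"
    define c where "c = (\<lambda>(\<kappa>, b). complex_of_real (if b then W N \<kappa> / 2 else - W N \<kappa>))"
    define I where "I = P N \<times> (UNIV :: bool set)"
    have "(\<Sum>i\<in>{i\<in>I. \<forall>x\<in>carrier G. \<eta> i x = 1}. Re (c i)) \<le> 3 / 2 * q ^ N"
    proof (rule Re_trivial_coefficients_le)
      show "finite I" by (simp add: I_def fin_P)
      show "\<eta> i \<in> hom G circle_group" for i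
        using m_hom hom_circle_times[OF \<xi> m_hom] by (cases i; cases "snd i") (auto simp: \<eta>_def)
    next
      fix x assume x: "x \<in> carrier G"
      have "(\<Sum>i\<in>I. c i * \<eta> i x) = (\<Sum>\<kappa>\<in>P N. \<Sum>b\<in>UNIV. c (\<kappa>, b) * \<eta> (\<kappa>, b) x)"
        by (simp add: I_def sum.cartesian_product)
      also have "\<dots> = (\<Sum>\<kappa>\<in>P N. (1 / 2 - \<xi> x) * (of_real (W N \<kappa>) * m N \<kappa> x))"
        by (simp add: UNIV_bool c_def \<eta>_def algebra_simps)
      also have "\<dots> = (1 / 2 - \<xi> x) * of_real (f x ^ N)"
        by (simp only: expansion[OF x] sum_distrib_left)
      finally have "Re (\<Sum>i\<in>I. c i * \<eta> i x) = (1 / 2 - Re (\<xi> x)) * f x ^ N" by simp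
      also have "\<dots> \<le> 3 / 2 * q ^ N"
      proof (cases "\<forall>i\<in>F. dist (h i x) 1 < \<delta>")
        case True
        then have "(1 / 2 - Re (\<xi> x)) * f x ^ N \<le> 0"
          using near[OF x] f_nonneg[OF x] by (intro mult_nonpos_nonneg) auto
        also have "0 \<le> 3 / 2 * q ^ N" using q by simp
        finally show ?thesis .
      next
        case False
        then have "f x ^ N \<le> q ^ N"
          using f_far[OF x] f_nonneg[OF x] by (intro power_mono) auto
        moreover have "1 / 2 - Re (\<xi> x) \<le> 3 / 2"
          using abs_Re_le_cmod[of "\<xi> x"] hom_circle_norm[OF \<xi> x] by simp
        ultimately show ?thesis
          using f_nonneg[OF x] by (intro mult_mono) auto
      qed
      finally show "Re (\<Sum>i\<in>I. c i * \<eta> i x) \<le> 3 / 2 * q ^ N" .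
    qed
    moreover have "W N (\<lambda>i\<in>F. N) / 2 \<le> (\<Sum>i\<in>{i\<in>I. \<forall>x\<in>carrier G. \<eta> i x = 1}. Re (c i))"
    proof -
      have "Re (c ((\<lambda>i\<in>F. N), True)) \<le> (\<Sum>i\<in>{i\<in>I. \<forall>x\<in>carrier G. \<eta> i x = 1}. Re (c i))"
      proof (rule member_le_sum)
        have "m N (\<lambda>i\<in>F. N) x = 1" for x by (simp add: m_def)
        then show "((\<lambda>i\<in>F. N), True) \<in> {i\<in>I. \<forall>x\<in>carrier G. \<eta> i x = 1}"
          by (auto simp: I_def P_def \<eta>_def)
        show "finite {i\<in>I. \<forall>x\<in>carrier G. \<eta> i x = 1}" by (simp add: I_def fin_P)
      next
        fix i assume "i \<in> {i\<in>I. \<forall>x\<in>carrier G. \<eta> i x = 1} - {((\<lambda>i\<in>F. N), True)}"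
        then have "snd i" using nontrivial by (cases i) (auto simp: \<eta>_def split: if_splits)
        then show "0 \<le> Re (c i)" using W_nonneg by (cases i) (auto simp: c_def)
      qed
      then show ?thesis by (simp add: c_def)
    qed
    ultimately show ?thesis by linarith
  qed
  \<comment> \<open>The central binomial coefficient is at least \<open>4 ^ N / (2 * N)\<close>, so
    the constant coefficient of the kernel decays no faster than a power of \<open>N\<close>,
    against the exponential \<open>q ^ N\<close>.\<close>
  have lower: "(1 / (2 * real N)) ^ card F \<le> 3 * q ^ N" if "N > 0" for N
  proof -
    have "1 / (2 * real N) \<le> w N N"
      using central_binomial_lower_bound[OF that] that by (simp add: w_def field_simps)
    then have "(1 / (2 * real N)) ^ card F \<le> w N N ^ card F"
      by (intro power_mono) auto
    also have "\<dots> = W N (\<lambda>i\<in>F. N)" by (simp add: W_def)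
    finally show ?thesis using bound[of N] by simp
  qed
  have "(\<lambda>N. 3 * 2 ^ card F * (real N ^ card F * q ^ N)) \<longlonglongrightarrow> 3 * 2 ^ card F * 0"
    by (intro tendsto_intros power_times_geometric_tendsto_0 q)
  then have "eventually (\<lambda>N. 3 * 2 ^ card F * (real N ^ card F * q ^ N) < 1) sequentially"
    by (rule order_tendstoD(2)) simp
  then have "eventually (\<lambda>N. 3 * 2 ^ card F * (real N ^ card F * q ^ N) < 1 \<and> N > 0) sequentially"
    using eventually_gt_at_top[of "0::nat"] by (rule eventually_conj)
  then obtain N where N: "3 * 2 ^ card F * (real N ^ card F * q ^ N) < 1" "N > 0"
    using eventually_happens'[OF sequentially_bot] by blast
  have "1 = (2 * real N) ^ card F * (1 / (2 * real N)) ^ card F"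
    unfolding power_mult_distrib[symmetric] using N(2) by simp
  also have "\<dots> \<le> (2 * real N) ^ card F * (3 * q ^ N)"
    using lower[OF N(2)] by (intro mult_left_mono) auto
  also have "\<dots> = 3 * 2 ^ card F * (real N ^ card F * q ^ N)"
    by (simp only: power_mult_distrib mult_ac)
  finally show False using N(1) by linarith
qed

section \<open>Dual groups and the compact-open topology\<close>

lemma topspace_compact_open [simp]: "topspace (compact_open_topology G T) = characters G T"
proof -
  have "characters G T \<in> {{\<phi> \<in> characters G T. \<phi> ` C \<subseteq> V} | C V. compactin T C \<and> openin circle_topology V}"
    by (auto intro!: exI[of _ "{}"])
  then show ?thesis
    unfolding compact_open_topology_def topology_generated_by_topspace by blast
qed

lemma character_continuous_euclidean:
  "\<phi> \<in> characters G T \<Longrightarrow> continuous_map T euclidean \<phi>"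
  by (auto simp: characters_def circle_topology_def continuous_map_in_subtopology)

text \<open>Characters map compact sets to compact sets. Such an image inside an open set has a
  uniform margin, so a subbasic set contains a uniform ball around each of its members. Conversely,
  covering the image by finitely many small balls yields finitely many subbasic sets whose
  intersection lies in a given uniform ball.\<close>

lemma openin_compact_open_iff:
  "openin (compact_open_topology G T) W \<longleftrightarrow>
     W \<subseteq> characters G T \<and>
     (\<forall>\<phi>\<in>W. \<exists>C e. compactin T C \<and> 0 < e \<and> {\<psi> \<in> characters G T. \<forall>x\<in>C. dist (\<psi> x) (\<phi> x) < e} \<subseteq> W)"
    (is "_ \<longleftrightarrow> ?P W")
proof
  assume "openin (compact_open_topology G T) W"
  then have "generate_topology_on {{\<phi> \<in> characters G T. \<phi> ` C \<subseteq> V} | C V. compactin T C \<and> openin circle_topology V} W"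
    unfolding compact_open_topology_def by (rule openin_topology_generated_by)
  then show "?P W"
  proof induction
    case Empty
    then show ?case by simp
  next
    case (Int a b)
    show ?case
    proof (intro conjI ballI)
      show "a \<inter> b \<subseteq> characters G T" using Int.IH by blast
    next
      fix \<phi> assume \<phi>: "\<phi> \<in> a \<inter> b"
      obtain C d where C: "compactin T C" "0 < d" "{\<psi> \<in> characters G T. \<forall>x\<in>C. dist (\<psi> x) (\<phi> x) < d} \<subseteq> a"
        using Int.IH(1) \<phi> by blast
      obtain D e where D: "compactin T D" "0 < e" "{\<psi> \<in> characters G T. \<forall>x\<in>D. dist (\<psi> x) (\<phi> x) < e} \<subseteq> b"
        using Int.IH(2) \<phi> by blast
      have "compactin T (C \<union> D)" "0 < min d e"
        using C D by (simp_all add: compactin_Un)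
      moreover have "{\<psi> \<in> characters G T. \<forall>x\<in>C \<union> D. dist (\<psi> x) (\<phi> x) < min d e} \<subseteq> a \<inter> b"
        using C(3) D(3) by auto
      ultimately show "\<exists>C e. compactin T C \<and> 0 < e
          \<and> {\<psi> \<in> characters G T. \<forall>x\<in>C. dist (\<psi> x) (\<phi> x) < e} \<subseteq> a \<inter> b"
        by blast
    qed
  next
    case (UN \<W>)
    then have sub: "\<Union>\<W> \<subseteq> characters G T" by blast
    show ?case
    proof (intro conjI ballI sub)
      fix \<phi> assume "\<phi> \<in> \<Union>\<W>"
      then obtain A where "A \<in> \<W>" "\<phi> \<in> A" by blast
      with UN.IH obtain C d where
        "compactin T C" "0 < d" "{\<psi> \<in> characters G T. \<forall>x\<in>C. dist (\<psi> x) (\<phi> x) < d} \<subseteq> A"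
        by blast
      with \<open>A \<in> \<W>\<close> show "\<exists>C e. compactin T C \<and> 0 < e
          \<and> {\<psi> \<in> characters G T. \<forall>x\<in>C. dist (\<psi> x) (\<phi> x) < e} \<subseteq> \<Union>\<W>"
        by blast
    qed
  next
    case (Basis W)
    then obtain C V where W: "W = {\<phi> \<in> characters G T. \<phi> ` C \<subseteq> V}"
      and C: "compactin T C" and V: "openin circle_topology V"
      by blast
    obtain O' where O': "open O'" "V = O' \<inter> sphere 0 1"
      using V by (auto simp: circle_topology_def openin_subtopology)
    have C_sub: "C \<subseteq> topspace T" using C by (rule compactin_subset_topspace)
    show ?case
    proof (intro conjI ballI)
      show "W \<subseteq> characters G T" using W by blast
    next
      fix \<phi> assume \<phi>: "\<phi> \<in> W"
      then have char: "\<phi> \<in> characters G T" by (simp add: W)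
      have "compact (\<phi> ` C)"
        using image_compactin[OF C character_continuous_euclidean[OF char]] by simp
      moreover have "\<phi> ` C \<subseteq> O'" using \<phi> O' W by blast
      ultimately obtain e where e: "e > 0" "(\<Union>z\<in>\<phi> ` C. ball z e) \<subseteq> O'"
        using compact_subset_open_imp_ball_epsilon_subset O'(1) by metis
      have "\<psi> \<in> W" if \<psi>: "\<psi> \<in> characters G T" and close: "\<forall>x\<in>C. dist (\<psi> x) (\<phi> x) < e" for \<psi>
      proof -
        have "\<psi> x \<in> V" if x: "x \<in> C" for x
        proof -
          have "\<psi> x \<in> ball (\<phi> x) e" using close x by (simp add: dist_commute)
          then have "\<psi> x \<in> O'" using e(2) x by blast
          moreover have "\<psi> x \<in> sphere 0 1"
            using \<psi> x C_sub
            by (auto simp: characters_def circle_topology_def continuous_map_in_subtopology)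
          ultimately show ?thesis using O'(2) by blast
        qed
        then show ?thesis using \<psi> W by blast
      qed
      with C e(1) show "\<exists>C e. compactin T C \<and> 0 < e
          \<and> {\<psi> \<in> characters G T. \<forall>x\<in>C. dist (\<psi> x) (\<phi> x) < e} \<subseteq> W"
        by blast
    qed
  qed
next
  assume W: "?P W"
  have "\<exists>V. openin (compact_open_topology G T) V \<and> \<phi> \<in> V \<and> V \<subseteq> W" if \<phi>: "\<phi> \<in> W" for \<phi>
  proof -
    obtain C e where C: "compactin T C" and e: "0 < e"
      and sub: "{\<psi> \<in> characters G T. \<forall>x\<in>C. dist (\<psi> x) (\<phi> x) < e} \<subseteq> W"
      using W \<phi> by blast
    have char: "\<phi> \<in> characters G T" using W \<phi> by blast
    have "compact (\<phi> ` C)"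
      using image_compactin[OF C character_continuous_euclidean[OF char]] by simp
    moreover have "\<phi> ` C \<subseteq> (\<Union>z\<in>\<phi> ` C. ball z (e / 3))"
    proof
      fix z assume "z \<in> \<phi> ` C"
      moreover have "z \<in> ball z (e / 3)" using e by simp
      ultimately show "z \<in> (\<Union>z\<in>\<phi> ` C. ball z (e / 3))" by (rule UN_I)
    qed
    ultimately obtain Z where Z: "finite Z" "\<phi> ` C \<subseteq> (\<Union>z\<in>Z. ball z (e / 3))"
      by (rule compactE_image[OF _ open_ball])
    \<comment> \<open>\<open>D z\<close> is the part of \<open>C\<close> that \<phi> sends near
      \<open>z\<close>, and the closed ball keeps it compact. The radius grows from
      \<open>e / 3\<close> to \<open>e / 2\<close> so that \<phi> itself belongs to
      \<open>N z\<close>; \<open>e / 3 + e / 2 < e\<close> then controls the distance to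
      \<phi>.\<close>
    define D where "D z = {x \<in> topspace T. \<phi> x \<in> cball z (e / 3)} \<inter> C" for z
    define N where "N z = {\<psi> \<in> characters G T. \<psi> ` D z \<subseteq> ball z (e / 2) \<inter> sphere 0 1}" for z
    have D: "compactin T (D z)" for z
      unfolding D_def
      by (intro closed_Int_compactin C closedin_continuous_map_preimage[OF character_continuous_euclidean[OF char]])
        simp
    have N_open: "openin (compact_open_topology G T) (N z)" for z
      unfolding compact_open_topology_def
    proof (rule topology_generated_by_Basis)
      have "openin circle_topology (ball z (e / 2) \<inter> sphere 0 1)"
        unfolding circle_topology_def openin_subtopology by auto
      then show "N z \<in> {{\<phi> \<in> characters G T. \<phi> ` C \<subseteq> V} | C V. compactin T C \<and> openin circle_topology V}"
        unfolding N_def using D by (intro CollectI exI[of _ "D z"] exI[of _ "ball z (e / 2) \<inter> sphere 0 1"]) simp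
    qed
    define V where "V = characters G T \<inter> (\<Inter>z\<in>Z. N z)"
    have "openin (compact_open_topology G T) V"
      using openin_INT[OF Z(1) N_open] by (simp add: V_def Int_commute)
    moreover have "\<phi> \<in> V"
    proof -
      have "\<phi> x \<in> ball z (e / 2) \<inter> sphere 0 1" if "x \<in> D z" for x z
        using that char e
        by (auto simp: D_def characters_def circle_topology_def continuous_map_in_subtopology)
      then show ?thesis using char by (auto simp: V_def N_def)
    qed
    moreover have "V \<subseteq> W"
    proof
      fix \<psi> assume \<psi>: "\<psi> \<in> V"
      have "dist (\<psi> x) (\<phi> x) < e" if x: "x \<in> C" for x
      proof -
        obtain z where z: "z \<in> Z" "\<phi> x \<in> ball z (e / 3)" using Z(2) x by blast
        have "x \<in> D z"
          using x z compactin_subset_topspace[OF C] by (auto simp: D_def)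
        then have "\<psi> x \<in> ball z (e / 2)" using \<psi> z(1) unfolding V_def N_def by blast
        then show ?thesis
          using z(2) e dist_triangle2[of "\<psi> x" "\<phi> x" z] by (simp add: dist_commute)
      qed
      then show "\<psi> \<in> W" using sub \<psi> by (auto simp: V_def)
    qed
    ultimately show ?thesis by blast
  qed
  then show "openin (compact_open_topology G T) W"
    by (subst openin_subopen) blast
qed

section \<open>The dual as a group, and its evaluation characters\<close>

lemma character_hom: "\<phi> \<in> characters G T \<Longrightarrow> \<phi> \<in> hom G circle_group"
  by (simp add: characters_def)

lemma character_extensional: "\<phi> \<in> characters G T \<Longrightarrow> \<phi> \<in> extensional (carrier G)"
  by (simp add: characters_def)

lemma topspace_pointwise [simp]:
  "topspace (pointwise_topology (characters G T) G) = characters G T"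
proof -
  have "characters G T \<subseteq> (\<Pi>\<^sub>E x\<in>carrier G. topspace circle_topology)"
    using hom_circle_norm[OF character_hom] character_extensional
    by (fastforce simp: circle_topology_def intro!: PiE_I dest: extensional_arb)
  then show ?thesis
    unfolding pointwise_topology_def topspace_subtopology topspace_product_topology by blast
qed

lemma charactersI:
  assumes "\<phi> \<in> hom G circle_group" "\<phi> \<in> extensional (carrier G)"
    and "topspace T = carrier G" "continuous_map T euclidean \<phi>"
  shows "\<phi> \<in> characters G T"
proof -
  have "\<phi> ` topspace T \<subseteq> sphere 0 1"
    using hom_circle_norm[OF assms(1)] assms(3) by auto
  then show ?thesis
    using assms by (simp add: characters_def circle_topology_def continuous_map_in_subtopology image_subset_iff_funcset)
qed

lemma character_mult_closed:
  assumes "group G" "topspace T = carrier G" "\<phi> \<in> characters G T" "\<psi> \<in> characters G T"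
  shows "(\<lambda>x\<in>carrier G. \<phi> x * \<psi> x) \<in> characters G T"
proof (rule charactersI)
  interpret group G by fact
  show "(\<lambda>x\<in>carrier G. \<phi> x * \<psi> x) \<in> hom G circle_group"
    using hom_circle_times[OF assms(3,4)[THEN character_hom]] by (auto simp: hom_def)
  have "continuous_map T euclidean (\<lambda>x. \<phi> x * \<psi> x)"
    using assms(3,4)[THEN character_continuous_euclidean]
    by (simp add: continuous_map_atin tendsto_mult)
  then show "continuous_map T euclidean (\<lambda>x\<in>carrier G. \<phi> x * \<psi> x)"
    by (rule continuous_map_eq) (simp add: assms(2))
qed (use assms in auto)

lemma group_dual_group:
  assumes "group G" "topspace T = carrier G"
  shows "group (dual_group G T)"
proof (rule groupI)
  interpret group G by fact
  show one: "\<one>\<^bsub>dual_group G T\<^esub> \<in> carrier (dual_group G T)"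
    using assms(2)
    by (auto simp: dual_group_def characters_def hom_def circle_group_def circle_topology_def
        continuous_map_in_subtopology intro: continuous_map_eq[of T euclidean "\<lambda>_. 1"])
  fix \<phi> assume \<phi>: "\<phi> \<in> carrier (dual_group G T)"
  then have char: "\<phi> \<in> characters G T" by (simp add: dual_group_def)
  note hom = character_hom[OF char]
  show "\<one>\<^bsub>dual_group G T\<^esub> \<otimes>\<^bsub>dual_group G T\<^esub> \<phi> = \<phi>"
    using character_extensional[OF char]
    by (auto simp: dual_group_def fun_eq_iff extensional_def)
  define \<psi> where "\<psi> = (\<lambda>x\<in>carrier G. cnj (\<phi> x))"
  have "\<psi> \<in> characters G T"
  proof (rule charactersI)
    show "\<psi> \<in> hom G circle_group"
      using hom by (auto simp: hom_def circle_group_def \<psi>_def)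
    have "continuous_map euclidean euclidean cnj"
      by (simp add: continuous_on_cnj)
    then have "continuous_map T euclidean (\<lambda>x. cnj (\<phi> x))"
      using continuous_map_compose[OF character_continuous_euclidean[OF char]] unfolding o_def by blast
    then show "continuous_map T euclidean \<psi>"
      unfolding \<psi>_def by (rule continuous_map_eq) (simp add: assms(2))
  qed (auto simp: \<psi>_def assms(2))
  moreover have "\<psi> \<otimes>\<^bsub>dual_group G T\<^esub> \<phi> = \<one>\<^bsub>dual_group G T\<^esub>"
    using hom_circle_norm[OF hom]
    by (auto simp: dual_group_def \<psi>_def fun_eq_iff mult.commute[of "cnj _"] complex_norm_square[symmetric])
  ultimately show "\<exists>\<psi>\<in>carrier (dual_group G T). \<psi> \<otimes>\<^bsub>dual_group G T\<^esub> \<phi> = \<one>\<^bsub>dual_group G T\<^esub>"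
    by (auto simp: dual_group_def)
next
  show "\<phi> \<otimes>\<^bsub>dual_group G T\<^esub> \<psi> \<in> carrier (dual_group G T)"
    if "\<phi> \<in> carrier (dual_group G T)" "\<psi> \<in> carrier (dual_group G T)" for \<phi> \<psi>
    using that character_mult_closed[OF assms] by (simp add: dual_group_def)
  show "\<phi> \<otimes>\<^bsub>dual_group G T\<^esub> \<psi> \<otimes>\<^bsub>dual_group G T\<^esub> \<theta>
      = \<phi> \<otimes>\<^bsub>dual_group G T\<^esub> (\<psi> \<otimes>\<^bsub>dual_group G T\<^esub> \<theta>)" for \<phi> \<psi> \<theta>
    unfolding dual_group_def by (simp add: restrict_def mult.assoc cong: if_cong)
qed

lemma (in group) hom_circle_int_pow:
  assumes "h \<in> hom G circle_group" "x \<in> carrier G"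
  shows "h (x [^] (k::int)) = h x powi k"
proof (cases "k < 0")
  case True
  have "h (x [^] k) = inverse (h (x [^] nat (- k)))"
    using True by (simp only: int_pow_def2 if_True hom_circle_inv[OF assms(1) nat_pow_closed[OF assms(2)]])
  then show ?thesis
    using True by (simp only: hom_circle_pow[OF assms]) (simp add: power_int_def power_inverse)
next
  case False
  have "h (x [^] k) = h (x [^] nat k)"
    using False by (simp only: int_pow_def2 if_False)
  then show ?thesis
    using False by (simp only: hom_circle_pow[OF assms]) (simp add: power_int_def)
qed

text \<open>Every homomorphism sends the product of the powers \<open>i [^] k i\<close> to the
  monomial, so one point serves all homomorphisms at once.\<close>

lemma (in group) hom_circle_monomial_eq_evaluation:
  assumes "finite F" "F \<subseteq> carrier G"
  shows "\<exists>x\<in>carrier G. \<forall>h\<in>hom G circle_group. (\<Prod>i\<in>F. h i powi k i) = h x"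
  using assms
proof (induction F rule: finite_induct)
  case empty
  then show ?case by (auto intro!: bexI[of _ \<one>] simp: hom_circle_one)
next
  case (insert i F)
  then obtain x where x: "x \<in> carrier G" "\<forall>h\<in>hom G circle_group. (\<Prod>i\<in>F. h i powi k i) = h x"
    by blast
  have i: "i \<in> carrier G" using insert.prems by simp
  have "(\<Prod>j\<in>insert i F. h j powi k j) = h (i [^] k i \<otimes> x)" if h: "h \<in> hom G circle_group" for h
    using insert.hyps x(2) h by (simp add: hom_circle_mult[OF h int_pow_closed[OF i] x(1)] hom_circle_int_pow[OF h i])
  then show ?case
    using int_pow_closed[OF i] x(1) by (intro bexI[of _ "i [^] k i \<otimes> x"]) auto
qed

lemma evaluation_character:
  assumes "group G" "topspace T = carrier G" "x \<in> carrier G"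
  shows "(\<lambda>\<phi>\<in>characters G T. \<phi> x) \<in> characters (dual_group G T) (pointwise_topology (characters G T) G)"
proof (rule charactersI)
  show "(\<lambda>\<phi>\<in>characters G T. \<phi> x) \<in> hom (dual_group G T) circle_group"
    using character_mult_closed[OF assms(1,2)] assms(3)
    by (auto simp: hom_def dual_group_def circle_group_def characters_def)
  have "continuous_map (pointwise_topology (characters G T) G) circle_topology (\<lambda>\<phi>. \<phi> x)"
    unfolding pointwise_topology_def
    by (intro continuous_map_from_subtopology continuous_map_product_projection assms(3))
  then have "continuous_map (pointwise_topology (characters G T) G) euclidean (\<lambda>\<phi>. \<phi> x)"
    by (simp add: circle_topology_def continuous_map_in_subtopology)
  then show "continuous_map (pointwise_topology (characters G T) G) euclidean (\<lambda>\<phi>\<in>characters G T. \<phi> x)"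
    by (rule continuous_map_eq) simp
qed (simp_all add: dual_group_def)

text \<open>This is the Comfort-Ross theorem. By continuity \<xi> has real part above 1/2 on a
  neighbourhood of the trivial character that restricts only finitely many coordinates. Hence \<xi>
  is a monomial in the evaluations at these coordinates, and such a monomial is evaluation at one
  point.\<close>

lemma pointwise_character_eq_evaluation:
  assumes "group G" "topspace T = carrier G"
    and \<xi>: "\<xi> \<in> characters (dual_group G T) (pointwise_topology (characters G T) G)"
  obtains x where "x \<in> carrier G" "\<And>\<phi>. \<phi> \<in> characters G T \<Longrightarrow> \<xi> \<phi> = \<phi> x"
proof -
  interpret group G by fact
  interpret dual: group "dual_group G T" using assms(1,2) by (rule group_dual_group)
  define e where "e = \<one>\<^bsub>dual_group G T\<^esub>"
  have e: "e \<in> characters G T" "\<And>x. x \<in> carrier G \<Longrightarrow> e x = 1"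
    using dual.one_closed by (auto simp: e_def dual_group_def)
  have carrier: "carrier (dual_group G T) = characters G T" by (simp add: dual_group_def)
  define U where "U = {\<phi> \<in> characters G T. \<xi> \<phi> \<in> {z. 1 / 2 < Re z}}"
  have "openin (pointwise_topology (characters G T) G) U"
    using openin_continuous_map_preimage[OF character_continuous_euclidean[OF \<xi>],
        of "{z. 1 / 2 < Re z}"] open_halfspace_Re_gt[of "1 / 2"]
    by (simp only: open_openin[symmetric] topspace_pointwise U_def)
  then obtain A where A: "openin (product_topology (\<lambda>_. circle_topology) (carrier G)) A"
    "U = A \<inter> characters G T"
    unfolding pointwise_topology_def openin_subtopology by blast
  have "e \<in> U"
    using e(1) dual.hom_circle_one[OF character_hom[OF \<xi>]] by (simp add: U_def e_def)
  then obtain V where V: "finite {i \<in> carrier G. V i \<noteq> topspace circle_topology}"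
    "\<forall>i\<in>carrier G. openin circle_topology (V i)" "e \<in> Pi\<^sub>E (carrier G) V" "Pi\<^sub>E (carrier G) V \<subseteq> A"
    using A unfolding openin_product_topology_alt by blast
  \<comment> \<open>Only these coordinates are restricted by the box \<open>V\<close>; at the others
    it allows the whole circle.\<close>
  define F where "F = {i \<in> carrier G. V i \<noteq> topspace circle_topology}"
  have F: "finite F" "F \<subseteq> carrier G" using V(1) by (auto simp: F_def)
  have "\<exists>d>0. \<forall>z\<in>sphere 0 1. dist z 1 < d \<longrightarrow> z \<in> V i" if i: "i \<in> F" for i
  proof -
    have "1 \<in> V i" using V(3) e(2) i F(2) by (metis PiE_mem subsetD)
    then show ?thesis
      using V(2) i F(2) unfolding circle_topology_def openin_euclidean_subtopology_iff by blast
  qed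
  then obtain d where d: "\<And>i. i \<in> F \<Longrightarrow> d i > 0"
    "\<And>i z. i \<in> F \<Longrightarrow> z \<in> sphere 0 1 \<Longrightarrow> dist z 1 < d i \<Longrightarrow> z \<in> V i"
    by metis
  \<comment> \<open>The inserted 1 keeps the minimum meaningful when \<open>F\<close> is
    empty.\<close>
  define \<delta> where "\<delta> = Min (insert 1 (d ` F))"
  have \<delta>: "\<delta> > 0" "\<And>i. i \<in> F \<Longrightarrow> \<delta> \<le> d i"
    using F(1) d(1) by (auto simp: \<delta>_def)
  have "\<exists>k :: 'a \<Rightarrow> int. \<forall>\<phi>\<in>carrier (dual_group G T). \<xi> \<phi> = (\<Prod>i\<in>F. \<phi> i powi k i)"
  \<comment> \<open>Here the group is the dual itself, and the homomorphisms on it are the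
    evaluations at the points of \<open>F\<close>.\<close>
  proof (rule dual.hom_circle_eq_monomial[where h = "\<lambda>i \<phi>. \<phi> i", OF F(1) _ character_hom[OF \<xi>] \<delta>(1)])
    show "(\<lambda>\<phi>. \<phi> i) \<in> hom (dual_group G T) circle_group" if "i \<in> F" for i
      using that F(2) by (auto simp: hom_def dual_group_def circle_group_def characters_def)
  next
    fix \<phi> assume \<phi>: "\<phi> \<in> carrier (dual_group G T)" "\<And>i. i \<in> F \<Longrightarrow> dist (\<phi> i) 1 < \<delta>"
    then have char: "\<phi> \<in> characters G T" by (simp add: carrier)
    have "\<phi> i \<in> V i" if i: "i \<in> carrier G" for i
    proof -
      have sphere: "\<phi> i \<in> sphere 0 1" using hom_circle_norm[OF character_hom[OF char] i] by simp
      show ?thesis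
      proof (cases "i \<in> F")
        case True
        then show ?thesis using d(2) sphere \<phi>(2) \<delta>(2) by fastforce
      next
        case False
        then show ?thesis using i sphere by (simp add: F_def circle_topology_def)
      qed
    qed
    then have "\<phi> \<in> U"
      using V(4) A(2) char character_extensional[OF char] by (auto simp: PiE_def)
    then show "1 / 2 \<le> Re (\<xi> \<phi>)" by (simp add: U_def)
  qed
  then obtain k :: "'a \<Rightarrow> int" where k: "\<And>\<phi>. \<phi> \<in> characters G T \<Longrightarrow> \<xi> \<phi> = (\<Prod>i\<in>F. \<phi> i powi k i)"
    by (auto simp: carrier)
  obtain x where "x \<in> carrier G" "\<forall>h\<in>hom G circle_group. (\<Prod>i\<in>F. h i powi k i) = h x"
    using hom_circle_monomial_eq_evaluation[OF F] by blast
  then show thesis using that k character_hom by metis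
qed

section \<open>The topology of uniform convergence on compact sets of characters\<close>

lemma dual_character_extensional:
  "\<xi> \<in> characters (dual_group G T) T' \<Longrightarrow> \<xi> \<in> extensional (characters G T)"
  by (drule character_extensional) (simp add: dual_group_def)

text \<open>The angle \<open>2 * pi * t\<close> runs through the interval from
  \<open>- pi / 2\<close> to \<open>pi / 2\<close>, where the cosine is nonnegative: the arc is the
  closed right half of the circle.\<close>

lemma T_plus_iff: "z \<in> T_plus \<longleftrightarrow> cmod z = 1 \<and> 0 \<le> Re z"
proof
  assume "z \<in> T_plus"
  then obtain t :: real where t: "- 1 / 4 \<le> t" "t \<le> 1 / 4" "z = exp (2 * of_real pi * \<i> * of_real t)"
    by (auto simp: T_plus_def)
  then have z: "z = cis (2 * pi * t)" by (simp add: cis_conv_exp mult_ac)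
  have "- (pi / 2) \<le> 2 * pi * t" "2 * pi * t \<le> pi / 2"
    using t mult_left_mono[OF t(1), of "2 * pi"] mult_left_mono[OF t(2), of "2 * pi"] by simp_all
  then show "cmod z = 1 \<and> 0 \<le> Re z" by (simp add: z cos_ge_zero)
next
  assume z: "cmod z = 1 \<and> 0 \<le> Re z"
  then have "z \<noteq> 0" by auto
  have "\<bar>Arg z\<bar> \<le> pi / 2" using z unfolding Arg_Re_nonneg ..
  then have t: "Arg z / (2 * pi) \<in> {- 1 / 4 .. 1 / 4}"
    using pi_gt_zero by (simp add: field_simps abs_le_iff) linarith
  have "z = exp (\<i> * of_real (Arg z))"
    using Arg_eq[OF \<open>z \<noteq> 0\<close>] z by simp
  also have "\<dots> = exp (2 * of_real pi * \<i> * of_real (Arg z / (2 * pi)))"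
    by simp
  finally show "z \<in> T_plus" unfolding T_plus_def using t by (rule image_eqI)
qed

text \<open>For unit \<open>z\<close> one has
  \<open>1 - Re (z\<^sup>2) = 2 * (1 - Re z) * (1 + Re z)\<close>, so squaring at least doubles
  \<open>1 - Re z\<close> while \<open>Re z\<close> is nonnegative. After \<open>m\<close> squarings
  this quantity is still at most 1.\<close>

lemma one_minus_Re_le:
  assumes "cmod z = 1" "\<And>j. j \<le> m \<Longrightarrow> 0 \<le> Re (z ^ (2 ^ j))"
  shows "1 - Re z \<le> (1 / 2) ^ m"
  using assms
proof (induction m arbitrary: z)
  case 0
  then show ?case using 0(2)[of 0] by simp
next
  case (Suc m)
  have "0 \<le> Re ((z\<^sup>2) ^ 2 ^ j)" if "j \<le> m" for j
    using Suc.prems(2)[of "Suc j"] that by (simp add: power_mult[symmetric])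
  then have IH: "1 - Re (z\<^sup>2) \<le> (1 / 2) ^ m"
    using Suc.prems(1) by (intro Suc.IH) (simp_all add: norm_power)
  have "(Re z)\<^sup>2 + (Im z)\<^sup>2 = 1"
    using Suc.prems(1) by (simp only: cmod_power2[symmetric]) simp
  then have sq: "1 - Re (z\<^sup>2) = 2 * (1 - Re z) * (1 + Re z)"
    by (simp add: power2_eq_square algebra_simps)
  have "0 \<le> Re z" using Suc.prems(2)[of 0] by simp
  moreover have "Re z \<le> 1" using complex_Re_le_cmod[of z] Suc.prems(1) by simp
  ultimately have "2 * (1 - Re z) * 1 \<le> 2 * (1 - Re z) * (1 + Re z)"
    by (intro mult_left_mono) auto
  then show ?case using IH sq by simp
qed

lemma topspace_tau_K [simp]: "topspace (tau_K G T) = carrier G"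
proof -
  have "{} \<in> compact_char_sets G T" by (simp add: compact_char_sets_def)
  then have "openin (tau_K G T) (carrier G)"
    unfolding openin_tau_K by (blast intro: zero_less_one)
  moreover have "topspace (tau_K G T) \<subseteq> carrier G"
    unfolding topspace_def openin_tau_K by blast
  ultimately show ?thesis using openin_subset by blast
qed

text \<open>A singleton of a continuous character is compact, so \<open>tau_K\<close> controls each
  such character on its own.\<close>

lemma characters_subset_tau_K: "characters G T \<subseteq> characters G (tau_K G T)"
proof
  fix \<phi> assume \<phi>: "\<phi> \<in> characters G T"
  then have sing: "{\<phi>} \<in> compact_char_sets G T"
    by (simp add: compact_char_sets_def)
  have "openin (tau_K G T) {x \<in> carrier G. \<phi> x \<in> O'}" if "open O'" for O'
    unfolding openin_tau_K
  proof (intro conjI ballI)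
    fix x assume x: "x \<in> {x \<in> carrier G. \<phi> x \<in> O'}"
    then have "\<phi> x \<in> O'" by simp
    with that obtain e where e: "e > 0" "ball (\<phi> x) e \<subseteq> O'"
      by (rule openE)
    have "{y \<in> carrier G. \<forall>\<psi>\<in>{\<phi>}. dist (\<psi> y) (\<psi> x) < e} \<subseteq> {x \<in> carrier G. \<phi> x \<in> O'}"
    proof
      fix y assume y: "y \<in> {y \<in> carrier G. \<forall>\<psi>\<in>{\<phi>}. dist (\<psi> y) (\<psi> x) < e}"
      then have "\<phi> y \<in> ball (\<phi> x) e" by (simp add: dist_commute)
      then show "y \<in> {x \<in> carrier G. \<phi> x \<in> O'}" using e(2) y by blast
    qed
    then show "\<exists>K\<in>compact_char_sets G T. \<exists>e>0.
        {y \<in> carrier G. \<forall>\<psi>\<in>K. dist (\<psi> y) (\<psi> x) < e} \<subseteq> {x \<in> carrier G. \<phi> x \<in> O'}"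
      using sing e(1) by blast
  qed blast
  then have "continuous_map (tau_K G T) euclidean \<phi>"
    by (simp add: continuous_map_def)
  then show "\<phi> \<in> characters G (tau_K G T)"
    by (rule charactersI[OF character_hom[OF \<phi>] character_extensional[OF \<phi>] topspace_tau_K])
qed

text \<open>The witness \<open>d\<close> makes the bound strict uniformly on \<open>K\<close>, with
  no appeal to an attained supremum. The gap \<open>e - d\<close> leaves room for a ball of radius
  \<open>(e - d) / 2\<close>.\<close>

lemma openin_tau_K_polar:
  assumes "K \<in> compact_char_sets G T"
  shows "openin (tau_K G T) {y \<in> carrier G. \<exists>d<e. \<forall>\<phi>\<in>K. dist (\<phi> y) 1 \<le> d}"
    (is "openin _ ?U")
  unfolding openin_tau_K
proof (intro conjI ballI)
  fix x assume "x \<in> ?U"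
  then obtain d where d: "d < e" "\<forall>\<phi>\<in>K. dist (\<phi> x) 1 \<le> d" by blast
  have "{y \<in> carrier G. \<forall>\<phi>\<in>K. dist (\<phi> y) (\<phi> x) < (e - d) / 2} \<subseteq> ?U"
  proof clarify
    fix y assume y: "y \<in> carrier G" "\<forall>\<phi>\<in>K. dist (\<phi> y) (\<phi> x) < (e - d) / 2"
    have "dist (\<phi> y) 1 \<le> (e + d) / 2" if "\<phi> \<in> K" for \<phi>
    proof -
      have "dist (\<phi> y) (\<phi> x) < (e - d) / 2" "dist (\<phi> x) 1 \<le> d" using that y(2) d(2) by auto
      then show ?thesis
        using dist_triangle[of "\<phi> y" 1 "\<phi> x"] by argo
    qed
    then show "\<exists>d<e. \<forall>\<phi>\<in>K. dist (\<phi> y) 1 \<le> d"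
      using d(1) by (intro exI[of _ "(e + d) / 2"]) auto
  qed
  then show "\<exists>K\<in>compact_char_sets G T. \<exists>d>0.
      {y \<in> carrier G. \<forall>\<phi>\<in>K. dist (\<phi> y) (\<phi> x) < d} \<subseteq> ?U"
    using assms d(1) by (intro bexI[of _ K] exI[of _ "(e - d) / 2"]) auto
qed blast

text \<open>Equicontinuity by way of \<open>T_plus\<close> only confines values to a half circle.
  Applied to the powers of \<open>y\<close> with exponents \<open>2 ^ j\<close>,
  \<open>j \<le> m\<close>, it gives closeness to 1, because a unit number whose repeated squares
  all stay in the right half is near 1.\<close>

lemma g_barrelled_tau_K_uniform:
  assumes "group G" and "g_barrelled G (tau_K G T)"
    and S: "compactin (pointwise_topology (characters G (tau_K G T)) G) S" and "e > 0"
  obtains K d where "K \<in> compact_char_sets G T" "d > 0"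
    "\<And>y \<phi>. y \<in> carrier G \<Longrightarrow> (\<And>\<psi>. \<psi> \<in> K \<Longrightarrow> dist (\<psi> y) 1 < d) \<Longrightarrow> \<phi> \<in> S \<Longrightarrow> dist (\<phi> y) 1 < e"
proof -
  interpret group G by fact
  have S_char: "\<phi> \<in> hom G circle_group" if "\<phi> \<in> S" for \<phi>
    using compactin_subset_topspace[OF S] that character_hom by auto
  obtain U where U: "openin (tau_K G T) U" "\<one>\<^bsub>G\<^esub> \<in> U" "\<And>\<phi> x. \<phi> \<in> S \<Longrightarrow> x \<in> U \<Longrightarrow> \<phi> x \<in> T_plus"
    using assms(2) S unfolding g_barrelled_def by metis
  then obtain K c where K: "K \<in> compact_char_sets G T" and c: "c > 0"
    "{y \<in> carrier G. \<forall>\<phi>\<in>K. dist (\<phi> y) (\<phi> \<one>\<^bsub>G\<^esub>) < c} \<subseteq> U"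
    unfolding openin_tau_K by blast
  have K_char: "\<psi> \<in> hom G circle_group" if "\<psi> \<in> K" for \<psi>
  proof -
    have "compactin (pointwise_topology (characters G T) G) K"
      using K by (simp add: compact_char_sets_def)
    then show ?thesis
      using compactin_subset_topspace that character_hom by fastforce
  qed
  \<comment> \<open>The squared distance of \<open>\<phi> y\<close> from 1 is
    \<open>2 * (1 - Re (\<phi> y))\<close>, which will be at most
    \<open>2 * (1 / 2) ^ m\<close>.\<close>
  have "(\<lambda>m. 2 * (1 / 2 :: real) ^ m) \<longlonglongrightarrow> 2 * 0"
    by (intro tendsto_intros) simp_all
  then have "eventually (\<lambda>m. 2 * (1 / 2 :: real) ^ m < e\<^sup>2) sequentially"
    by (rule order_tendstoD(2)) (use \<open>e > 0\<close> in simp)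
  then obtain m where m: "2 * (1 / 2 :: real) ^ m < e\<^sup>2"
    using eventually_happens'[OF sequentially_bot] by blast
  show thesis
  proof (rule that[OF K, of "c / 2 ^ m"])
    show "c / 2 ^ m > 0" using c by simp
    fix y \<phi>
    assume y: "y \<in> carrier G" and small: "\<And>\<psi>. \<psi> \<in> K \<Longrightarrow> dist (\<psi> y) 1 < c / 2 ^ m" and \<phi>: "\<phi> \<in> S"
    \<comment> \<open>Taking the \<open>n\<close>-th power multiplies the distance of a unit number
      from 1 by at most \<open>n\<close>, and here \<open>n\<close> is at most \<open>2 ^ m\<close>;
      hence the radius \<open>c / 2 ^ m\<close>.\<close>
    have in_U: "y [^]\<^bsub>G\<^esub> (2 ^ j :: nat) \<in> U" if j: "j \<le> m" for j
    proof -
      have "dist (\<psi> (y [^]\<^bsub>G\<^esub> (2 ^ j :: nat))) (\<psi> \<one>\<^bsub>G\<^esub>) < c" if \<psi>: "\<psi> \<in> K" for \<psi>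
      proof -
        have "dist (\<psi> (y [^]\<^bsub>G\<^esub> (2 ^ j :: nat))) (\<psi> \<one>\<^bsub>G\<^esub>) = norm (\<psi> y ^ 2 ^ j - 1 ^ 2 ^ j)"
          by (simp add: hom_circle_pow[OF K_char[OF \<psi>] y] hom_circle_one[OF K_char[OF \<psi>]] dist_norm)
        also have "\<dots> \<le> real (2 ^ j) * norm (\<psi> y - 1)"
          using hom_circle_norm[OF K_char[OF \<psi>] y] by (intro norm_power_diff) simp_all
        also have "\<dots> \<le> 2 ^ m * norm (\<psi> y - 1)"
          using j by (intro mult_right_mono) (simp_all add: power_increasing)
        also have "\<dots> < 2 ^ m * (c / 2 ^ m)"
          using small[OF \<psi>] by (intro mult_strict_left_mono) (simp_all add: dist_norm)
        finally show ?thesis by simp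
      qed
      then show ?thesis using c(2) y by blast
    qed
    have norm: "cmod (\<phi> y) = 1" using hom_circle_norm[OF S_char[OF \<phi>] y] .
    have "0 \<le> Re (\<phi> y ^ 2 ^ j)" if "j \<le> m" for j
      using U(3)[OF \<phi> in_U[OF that]] by (simp only: T_plus_iff hom_circle_pow[OF S_char[OF \<phi>] y])
    then have "1 - Re (\<phi> y) \<le> (1 / 2) ^ m" by (rule one_minus_Re_le[OF norm])
    then have "(dist (\<phi> y) 1)\<^sup>2 < e\<^sup>2"
      using m unfolding dist_norm unit_dist_1_squared[OF norm] by linarith
    then show "dist (\<phi> y) 1 < e"
      by (rule power_less_imp_less_base) (use \<open>e > 0\<close> in simp)
  qed
qed

text \<open>A point \<open>y\<close> of \<open>G\<close> represents the same character of both groups, so surjectivity comes from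
  extending evaluations and injectivity from the separation of points.\<close>

lemma restriction_iso:
  assumes "group G" "topspace T = carrier G" "topspace T' = carrier G"
    and sub: "characters G T \<subseteq> characters G T'"
    and sep: "separates_points G (characters G T)"
  shows "restriction_map (dual_group G T)
    \<in> iso (dual_group (dual_group G T') (pointwise_topology (characters G T') G))
          (dual_group (dual_group G T) (pointwise_topology (characters G T) G))"
proof -
  define X where "X = characters (dual_group G T') (pointwise_topology (characters G T') G)"
  define Y where "Y = characters (dual_group G T) (pointwise_topology (characters G T) G)"
  define r where "r = restriction_map (dual_group G T)"
  have r: "r \<xi> = restrict \<xi> (characters G T)" for \<xi>
    by (simp add: r_def restriction_map_def dual_group_def)
  have X_eval: "\<exists>x\<in>carrier G. \<xi> = (\<lambda>\<phi>\<in>characters G T'. \<phi> x)" if \<xi>: "\<xi> \<in> X" for \<xi>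
  proof -
    obtain x where "x \<in> carrier G" "\<And>\<phi>. \<phi> \<in> characters G T' \<Longrightarrow> \<xi> \<phi> = \<phi> x"
      using pointwise_character_eq_evaluation[OF assms(1,3) \<xi>[unfolded X_def]] by blast
    moreover have "\<xi> \<in> extensional (characters G T')"
      using \<xi> unfolding X_def by (rule dual_character_extensional)
    ultimately show ?thesis by (intro bexI[of _ x] extensionalityI) auto
  qed
  have Y_eval: "\<exists>x\<in>carrier G. \<xi> = (\<lambda>\<phi>\<in>characters G T. \<phi> x)" if \<xi>: "\<xi> \<in> Y" for \<xi>
  proof -
    obtain x where "x \<in> carrier G" "\<And>\<phi>. \<phi> \<in> characters G T \<Longrightarrow> \<xi> \<phi> = \<phi> x"
      using pointwise_character_eq_evaluation[OF assms(1,2) \<xi>[unfolded Y_def]] by blast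
    moreover have "\<xi> \<in> extensional (characters G T)"
      using \<xi> unfolding Y_def by (rule dual_character_extensional)
    ultimately show ?thesis by (intro bexI[of _ x] extensionalityI) auto
  qed
  have r_eval: "r (\<lambda>\<phi>\<in>characters G T'. \<phi> x) = (\<lambda>\<phi>\<in>characters G T. \<phi> x)" for x
    using sub by (auto simp: r restrict_def fun_eq_iff)
  have r_Y: "r \<xi> \<in> Y" if "\<xi> \<in> X" for \<xi>
    using X_eval[OF that] r_eval evaluation_character[OF assms(1,2)] by (auto simp: Y_def)
  have "bij_betw r X Y"
    unfolding bij_betw_def
  proof
    show "inj_on r X"
    proof (rule inj_onI)
      fix \<xi> \<zeta> assume "\<xi> \<in> X" "\<zeta> \<in> X" and eq: "r \<xi> = r \<zeta>"
      then obtain x y where x: "x \<in> carrier G" "\<xi> = (\<lambda>\<phi>\<in>characters G T'. \<phi> x)"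
        and y: "y \<in> carrier G" "\<zeta> = (\<lambda>\<phi>\<in>characters G T'. \<phi> y)"
        using X_eval by meson
      have "\<phi> x = \<phi> y" if "\<phi> \<in> characters G T" for \<phi>
        using fun_cong[OF eq, of \<phi>] that by (simp add: x(2) y(2) r_eval)
      then have "x = y" using sep x(1) y(1) unfolding separates_points_def by blast
      then show "\<xi> = \<zeta>" using x(2) y(2) by simp
    qed
    show "r ` X = Y"
    proof
      show "r ` X \<subseteq> Y" using r_Y by blast
      show "Y \<subseteq> r ` X"
      proof
        fix \<xi> assume "\<xi> \<in> Y"
        then obtain x where x: "x \<in> carrier G" "\<xi> = (\<lambda>\<phi>\<in>characters G T. \<phi> x)"
          using Y_eval by meson
        then show "\<xi> \<in> r ` X"
          using r_eval[of x] evaluation_character[OF assms(1,3) x(1)]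
          unfolding X_def by (metis image_eqI)
      qed
    qed
  qed
  moreover have "r \<in> hom (dual_group (dual_group G T') (pointwise_topology (characters G T') G))
          (dual_group (dual_group G T) (pointwise_topology (characters G T) G))"
  proof (rule homI)
    show "r \<xi> \<in> carrier (dual_group (dual_group G T) (pointwise_topology (characters G T) G))"
      if "\<xi> \<in> carrier (dual_group (dual_group G T') (pointwise_topology (characters G T') G))" for \<xi>
      using that r_Y[of \<xi>] by (simp add: dual_group_def[of "dual_group _ _"] X_def Y_def)
    show "r (\<xi> \<otimes>\<^bsub>dual_group (dual_group G T') (pointwise_topology (characters G T') G)\<^esub> \<zeta>)
      = r \<xi> \<otimes>\<^bsub>dual_group (dual_group G T) (pointwise_topology (characters G T) G)\<^esub> r \<zeta>" for \<xi> \<zeta>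
      using sub by (auto simp: dual_group_def r restrict_def fun_eq_iff)
  qed
  ultimately show ?thesis
    unfolding r_def by (intro isoI) (simp_all add: dual_group_def[of "dual_group _ _"] X_def Y_def)
qed

section \<open>Continuity and openness of restriction between the two duals\<close>

lemma dist_unit_quotient:
  fixes a b :: complex
  assumes "cmod b = 1"
  shows "dist (a * inverse b) 1 = dist a b"
proof -
  have "b \<noteq> 0" using assms by auto
  then have "a * inverse b - 1 = (a - b) * inverse b" by (simp add: field_simps)
  then show ?thesis using assms by (simp add: dist_norm norm_mult norm_inverse)
qed

theorem theorem4p8:
  fixes G :: "('a, 'b) monoid_scheme" and \<tau> :: "'a topology"
  assumes "topological_abelian_group G \<tau>"
    and "separates_points G (characters G \<tau>)"
  shows "g_barrelled G (tau_K G \<tau>) \<longleftrightarrow>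
    determines
      (dual_group G \<tau>) (pointwise_topology (characters G \<tau>) G)
      (dual_group G (tau_K G \<tau>)) (pointwise_topology (characters G (tau_K G \<tau>)) G)"
proof -
  interpret comm_group G using assms(1) by (simp add: topological_abelian_group_def)
  have grp: "group G" by (rule group_axioms)
  have top: "topspace \<tau> = carrier G" using assms(1) by (simp add: topological_abelian_group_def)
  define L where "L = characters G \<tau>"
  define J where "J = characters G (tau_K G \<tau>)"
  define X where "X = characters (dual_group G (tau_K G \<tau>)) (pointwise_topology J G)"
  define Y where "Y = characters (dual_group G \<tau>) (pointwise_topology L G)"
  define r where "r = restriction_map (dual_group G \<tau>)"
  have r: "r \<xi> = restrict \<xi> L" for \<xi>
    by (simp add: r_def restriction_map_def dual_group_def L_def)
  have LJ: "L \<subseteq> J" unfolding L_def J_def by (rule characters_subset_tau_K)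
  have top_L: "pointwise_topology L G = subtopology (pointwise_topology J G) L"
    using LJ by (simp add: pointwise_topology_def subtopology_subtopology Int_absorb1)
  have iso: "r \<in> iso (dual_group (dual_group G (tau_K G \<tau>)) (pointwise_topology J G))
      (dual_group (dual_group G \<tau>) (pointwise_topology L G))"
    unfolding r_def L_def J_def
    by (rule restriction_iso[OF grp top topspace_tau_K characters_subset_tau_K assms(2)])
  then have bij: "bij_betw r X Y"
    by (simp add: iso_def X_def Y_def dual_group_def[of "dual_group _ _"])
  have L_hom: "\<phi> \<in> hom G circle_group" if "\<phi> \<in> L" for \<phi>
    using that character_hom by (simp add: L_def)
  have J_hom: "\<phi> \<in> hom G circle_group" if "\<phi> \<in> J" for \<phi>
    using that character_hom by (simp add: J_def)
  have ev_X: "(\<lambda>\<phi>\<in>J. \<phi> x) \<in> X" if "x \<in> carrier G" for x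
    unfolding X_def J_def by (rule evaluation_character[OF grp topspace_tau_K that])
  have r_ev: "r (\<lambda>\<phi>\<in>J. \<phi> x) = (\<lambda>\<phi>\<in>L. \<phi> x)" for x
    using LJ by (auto simp: r restrict_def fun_eq_iff)
  have compact_L: "K \<subseteq> L" if "compactin (pointwise_topology L G) K" for K
    using compactin_subset_topspace[OF that] by (simp add: L_def)
  have compact_J: "S \<subseteq> J" if "compactin (pointwise_topology J G) S" for S
    using compactin_subset_topspace[OF that] by (simp add: J_def)
  have K_iff: "K \<in> compact_char_sets G \<tau> \<longleftrightarrow> compactin (pointwise_topology L G) K" for K
    by (simp add: compact_char_sets_def L_def)
  have subgroup: "subgroup L (dual_group G (tau_K G \<tau>))"
  proof (rule group.group_incl_imp_subgroup)
    show "group (dual_group G (tau_K G \<tau>))" by (rule group_dual_group[OF grp topspace_tau_K])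
    show "L \<subseteq> carrier (dual_group G (tau_K G \<tau>))" using LJ by (simp add: dual_group_def J_def)
    have "dual_group G (tau_K G \<tau>)\<lparr>carrier := L\<rparr> = dual_group G \<tau>"
      by (simp add: dual_group_def L_def)
    then show "group (dual_group G (tau_K G \<tau>)\<lparr>carrier := L\<rparr>)"
      using group_dual_group[OF grp top] by simp
  qed
  define CX where "CX = compact_open_topology (dual_group G (tau_K G \<tau>)) (pointwise_topology J G)"
  define CY where "CY = compact_open_topology (dual_group G \<tau>) (pointwise_topology L G)"
  have CX: "openin CX W \<longleftrightarrow> W \<subseteq> X \<and> (\<forall>\<xi>\<in>W. \<exists>S e. compactin (pointwise_topology J G) S \<and> 0 < e
      \<and> {\<zeta> \<in> X. \<forall>\<phi>\<in>S. dist (\<zeta> \<phi>) (\<xi> \<phi>) < e} \<subseteq> W)" for W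
    unfolding CX_def X_def by (rule openin_compact_open_iff)
  have CY: "openin CY W \<longleftrightarrow> W \<subseteq> Y \<and> (\<forall>\<xi>\<in>W. \<exists>S e. compactin (pointwise_topology L G) S \<and> 0 < e
      \<and> {\<zeta> \<in> Y. \<forall>\<phi>\<in>S. dist (\<zeta> \<phi>) (\<xi> \<phi>) < e} \<subseteq> W)" for W
    unfolding CY_def Y_def by (rule openin_compact_open_iff)
  have top_CX: "topspace CX = X" and top_CY: "topspace CY = Y"
    by (simp_all add: CX_def CY_def X_def Y_def)
  \<comment> \<open>The algebraic conditions and the induced topology on \<open>L\<close> are
    settled, so only the homeomorphism remains in question.\<close>
  have det: "determines (dual_group G \<tau>) (pointwise_topology L G)
      (dual_group G (tau_K G \<tau>)) (pointwise_topology J G) \<longleftrightarrow> homeomorphic_map CX CY r"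
    using subgroup iso top_L
    by (simp add: determines_def CX_def CY_def r_def) (simp add: dual_group_def L_def)
  \<comment> \<open>A compact subset of \<open>L\<close> is also compact in \<open>J\<close>, and
    restriction changes no values on it, so the same set and radius work for the preimage.\<close>
  have cont: "continuous_map CX CY r"
    unfolding continuous_map_def top_CX top_CY
  proof (intro conjI allI impI)
    show "r \<in> X \<rightarrow> Y" using bij by (auto simp: bij_betw_def)
    fix W assume W: "openin CY W"
    show "openin CX {\<xi> \<in> X. r \<xi> \<in> W}"
      unfolding CX
    proof (intro conjI ballI)
      fix \<xi> assume "\<xi> \<in> {\<xi> \<in> X. r \<xi> \<in> W}"
      then obtain C e where C: "compactin (pointwise_topology L G) C" "0 < e"
        "{\<zeta> \<in> Y. \<forall>\<phi>\<in>C. dist (\<zeta> \<phi>) (r \<xi> \<phi>) < e} \<subseteq> W"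
        using W unfolding CY by blast
      have "compactin (pointwise_topology J G) C"
        using C(1) unfolding top_L compactin_subtopology by blast
      moreover have "{\<zeta> \<in> X. \<forall>\<phi>\<in>C. dist (\<zeta> \<phi>) (\<xi> \<phi>) < e} \<subseteq> {\<xi> \<in> X. r \<xi> \<in> W}"
      proof
        fix \<zeta> assume "\<zeta> \<in> {\<zeta> \<in> X. \<forall>\<phi>\<in>C. dist (\<zeta> \<phi>) (\<xi> \<phi>) < e}"
        then have \<zeta>: "\<zeta> \<in> X" "\<forall>\<phi>\<in>C. dist (\<zeta> \<phi>) (\<xi> \<phi>) < e" by auto
        have "r \<zeta> \<in> Y" using bij \<zeta>(1) by (auto simp: bij_betw_def)
        moreover have "\<forall>\<phi>\<in>C. dist (r \<zeta> \<phi>) (r \<xi> \<phi>) < e"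
          using \<zeta>(2) compact_L[OF C(1)] by (auto simp: r)
        ultimately show "\<zeta> \<in> {\<xi> \<in> X. r \<xi> \<in> W}" using C(3) \<zeta>(1) by blast
      qed
      ultimately show "\<exists>S e. compactin (pointwise_topology J G) S \<and> 0 < e
          \<and> {\<zeta> \<in> X. \<forall>\<phi>\<in>S. dist (\<zeta> \<phi>) (\<xi> \<phi>) < e} \<subseteq> {\<xi> \<in> X. r \<xi> \<in> W}"
        using C(2) by blast
    qed blast
  qed
  have "g_barrelled G (tau_K G \<tau>) \<longleftrightarrow> homeomorphic_map CX CY r"
  proof
    assume barrelled: "g_barrelled G (tau_K G \<tau>)"
    \<comment> \<open>Let \<xi> be evaluation at \<open>x\<close>, with a ball around it in
      \<open>W\<close> given by \<open>S\<close> and \<open>e\<close>. Barrelledness supplies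
      \<open>K\<close> and \<open>d\<close>: if evaluation at \<open>y\<close> is within
      \<open>d\<close> of that at \<open>x\<close> on \<open>K\<close>, then \<open>y\<close> times
      the inverse of \<open>x\<close> is small on \<open>K\<close>, hence on \<open>S\<close>, and
      evaluation at \<open>y\<close> on \<open>J\<close> lies in \<open>W\<close>.\<close>
    have "openin CY (r ` W)" if W: "openin CX W" for W
      unfolding CY
    proof (intro conjI ballI)
      show "r ` W \<subseteq> Y" using W bij unfolding CX by (auto simp: bij_betw_def)
      fix \<xi>' assume "\<xi>' \<in> r ` W"
      then obtain \<xi> where \<xi>: "\<xi> \<in> W" "\<xi>' = r \<xi>" by blast
      then obtain S e where S: "compactin (pointwise_topology J G) S" and e: "0 < e"
        and sub: "{\<zeta> \<in> X. \<forall>\<phi>\<in>S. dist (\<zeta> \<phi>) (\<xi> \<phi>) < e} \<subseteq> W"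
        using W unfolding CX by blast
      have \<xi>_X: "\<xi> \<in> characters (dual_group G (tau_K G \<tau>)) (pointwise_topology (characters G (tau_K G \<tau>)) G)"
        using \<xi>(1) W unfolding CX X_def J_def by blast
      obtain x where x: "x \<in> carrier G" "\<And>\<phi>. \<phi> \<in> J \<Longrightarrow> \<xi> \<phi> = \<phi> x"
        using pointwise_character_eq_evaluation[OF grp topspace_tau_K \<xi>_X] unfolding J_def by blast
      obtain K d where K: "K \<in> compact_char_sets G \<tau>" "d > 0"
        and uniform: "\<And>y \<phi>. y \<in> carrier G \<Longrightarrow> (\<And>\<psi>. \<psi> \<in> K \<Longrightarrow> dist (\<psi> y) 1 < d) \<Longrightarrow> \<phi> \<in> S
          \<Longrightarrow> dist (\<phi> y) 1 < e"
        using g_barrelled_tau_K_uniform[OF grp barrelled S[unfolded J_def] e] by blast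
      have K_L: "compactin (pointwise_topology L G) K" using K(1) by (simp add: K_iff)
      have "{\<zeta> \<in> Y. \<forall>\<phi>\<in>K. dist (\<zeta> \<phi>) (\<xi>' \<phi>) < d} \<subseteq> r ` W"
      proof
        fix \<zeta> assume "\<zeta> \<in> {\<zeta> \<in> Y. \<forall>\<phi>\<in>K. dist (\<zeta> \<phi>) (\<xi>' \<phi>) < d}"
        then have \<zeta>: "\<zeta> \<in> Y" "\<forall>\<phi>\<in>K. dist (\<zeta> \<phi>) (\<xi>' \<phi>) < d" by auto
        have \<zeta>_Y: "\<zeta> \<in> characters (dual_group G \<tau>) (pointwise_topology (characters G \<tau>) G)"
          using \<zeta>(1) by (simp add: Y_def L_def)
        obtain y where y: "y \<in> carrier G" "\<And>\<phi>. \<phi> \<in> L \<Longrightarrow> \<zeta> \<phi> = \<phi> y"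
          using pointwise_character_eq_evaluation[OF grp top \<zeta>_Y] unfolding L_def by blast
        \<comment> \<open>Multiplication by a unit number is an isometry, which moves the comparison
          of \<open>y\<close> with \<open>x\<close> to the unit of \<open>G\<close>.\<close>
        have quotient: "dist (\<phi> (y \<otimes>\<^bsub>G\<^esub> inv\<^bsub>G\<^esub> x)) 1 = dist (\<phi> y) (\<phi> x)" if "\<phi> \<in> hom G circle_group" for \<phi>
          using dist_unit_quotient[OF hom_circle_norm[OF that x(1)]] y(1) x(1)
          by (simp add: hom_circle_mult[OF that] hom_circle_inv[OF that])
        have "dist (\<psi> (y \<otimes>\<^bsub>G\<^esub> inv\<^bsub>G\<^esub> x)) 1 < d" if \<psi>: "\<psi> \<in> K" for \<psi>
        proof -
          have "\<psi> \<in> L" using compact_L[OF K_L] \<psi> by blast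
          then have "\<zeta> \<psi> = \<psi> y" "\<xi>' \<psi> = \<psi> x" using y(2) x(2) LJ \<xi>(2) by (auto simp: r)
          then show ?thesis using \<zeta>(2) \<psi> quotient[OF L_hom[OF \<open>\<psi> \<in> L\<close>]] by fastforce
        qed
        then have close: "dist (\<phi> (y \<otimes>\<^bsub>G\<^esub> inv\<^bsub>G\<^esub> x)) 1 < e" if "\<phi> \<in> S" for \<phi>
          using uniform[of "y \<otimes>\<^bsub>G\<^esub> inv\<^bsub>G\<^esub> x"] x(1) y(1) that by blast
        have "dist ((\<lambda>\<phi>\<in>J. \<phi> y) \<phi>) (\<xi> \<phi>) < e" if \<phi>: "\<phi> \<in> S" for \<phi>
        proof -
          have "\<phi> \<in> J" using compact_J[OF S] \<phi> by blast
          then show ?thesis using close[OF \<phi>] quotient[OF J_hom] x(2) by simp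
        qed
        then have "(\<lambda>\<phi>\<in>J. \<phi> y) \<in> W" using sub ev_X[OF y(1)] by blast
        moreover have "\<zeta> = r (\<lambda>\<phi>\<in>J. \<phi> y)"
        proof -
          have "\<zeta> \<in> extensional L"
            using dual_character_extensional[OF \<zeta>_Y] by (simp add: L_def)
          then show ?thesis
            unfolding r_ev using y(2) by (intro extensionalityI) auto
        qed
        ultimately show "\<zeta> \<in> r ` W" by blast
      qed
      with K_L K(2) show "\<exists>S e. compactin (pointwise_topology L G) S \<and> 0 < e
          \<and> {\<zeta> \<in> Y. \<forall>\<phi>\<in>S. dist (\<zeta> \<phi>) (\<xi>' \<phi>) < e} \<subseteq> r ` W"
        by blast
    qed
    then have "open_map CX CY r" by (simp add: open_map_def)
    then show "homeomorphic_map CX CY r"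
      using bij cont by (intro bijective_open_imp_homeomorphic_map) (simp_all add: top_CX top_CY bij_betw_def)
  next
    assume homeo: "homeomorphic_map CX CY r"
    show "g_barrelled G (tau_K G \<tau>)"
      unfolding g_barrelled_def
    proof (intro allI impI)
      fix S assume "compactin (pointwise_topology (characters G (tau_K G \<tau>)) G) S"
      then have S: "compactin (pointwise_topology J G) S" by (simp add: J_def)
      \<comment> \<open>The open half circle lies in \<open>T_plus\<close>, and its openness makes
        \<open>W\<close> a subbasic neighbourhood of the trivial character.\<close>
      define V where "V = {z. 0 < Re z} \<inter> sphere 0 1"
      define W where "W = {\<xi> \<in> X. \<xi> ` S \<subseteq> V}"
      have "openin circle_topology V"
        unfolding V_def circle_topology_def openin_subtopology
        using open_halfspace_Re_gt[of 0] by auto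
      then have "openin CX W"
        unfolding CX_def compact_open_topology_def W_def X_def
        using S by (intro topology_generated_by_Basis) blast
      then have "openin CY (r ` W)"
        using homeomorphic_map_openness[OF homeo] openin_subset by blast
      moreover have "(\<lambda>\<phi>\<in>J. \<phi> \<one>\<^bsub>G\<^esub>) \<in> W"
      proof -
        have "\<phi> \<one>\<^bsub>G\<^esub> \<in> V" if "\<phi> \<in> S" for \<phi>
          using compact_J[OF S] that by (simp add: V_def hom_circle_one[OF J_hom] subset_iff)
        then show ?thesis
          using ev_X[OF one_closed] compact_J[OF S] by (auto simp: W_def)
      qed
      then have "(\<lambda>\<phi>\<in>L. \<phi> \<one>\<^bsub>G\<^esub>) \<in> r ` W" using r_ev by (metis imageI)
      ultimately obtain K e where K: "compactin (pointwise_topology L G) K" and e: "0 < e"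
        and sub: "{\<zeta> \<in> Y. \<forall>\<phi>\<in>K. dist (\<zeta> \<phi>) ((\<lambda>\<phi>\<in>L. \<phi> \<one>\<^bsub>G\<^esub>) \<phi>) < e} \<subseteq> r ` W"
        unfolding CY by blast
      \<comment> \<open>For \<open>y\<close> in \<open>U\<close>, evaluation at \<open>y\<close> on
        \<open>L\<close> is within \<open>e\<close> of the trivial character on \<open>K\<close>, so
        it belongs to the image of \<open>W\<close>.\<close>
      define U where "U = {y \<in> carrier G. \<exists>d<e. \<forall>\<phi>\<in>K. dist (\<phi> y) 1 \<le> d}"
      have "openin (tau_K G \<tau>) U"
        unfolding U_def using K by (intro openin_tau_K_polar) (simp add: K_iff)
      moreover have "\<one>\<^bsub>G\<^esub> \<in> U"
      proof -
        have "\<forall>\<phi>\<in>K. dist (\<phi> \<one>\<^bsub>G\<^esub>) 1 \<le> 0"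
          using compact_L[OF K] by (simp add: hom_circle_one[OF L_hom] subset_iff)
        then show ?thesis using e by (auto simp: U_def)
      qed
      moreover have "\<phi> y \<in> T_plus" if \<phi>: "\<phi> \<in> S" and y: "y \<in> U" for \<phi> y
      proof -
        have carr: "y \<in> carrier G" using y by (simp add: U_def)
        have "r (\<lambda>\<phi>\<in>J. \<phi> y) \<in> Y" using bij ev_X[OF carr] by (auto simp: bij_betw_def)
        moreover have "dist (r (\<lambda>\<phi>\<in>J. \<phi> y) \<psi>) ((\<lambda>\<phi>\<in>L. \<phi> \<one>\<^bsub>G\<^esub>) \<psi>) < e" if \<psi>: "\<psi> \<in> K" for \<psi>
        proof -
          have "\<psi> \<in> L" using compact_L[OF K] \<psi> by blast
          moreover have "dist (\<psi> y) 1 < e" using y \<psi> by (force simp: U_def)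
          ultimately show ?thesis by (simp add: r_ev hom_circle_one[OF L_hom])
        qed
        ultimately have "r (\<lambda>\<phi>\<in>J. \<phi> y) \<in> r ` W" using sub by blast
        \<comment> \<open>Injectivity of \<open>r\<close> leads back from the image to
          \<open>W\<close>, whose members are controlled on all of \<open>S\<close> and not only on
          \<open>L\<close>.\<close>
        then have "(\<lambda>\<phi>\<in>J. \<phi> y) \<in> W"
          using bij ev_X[OF carr] unfolding bij_betw_def
          by (metis (no_types, lifting) W_def inj_on_image_mem_iff mem_Collect_eq subsetI)
        moreover have "\<phi> \<in> J" using compact_J[OF S] \<phi> by blast
        ultimately have "\<phi> y \<in> V" using \<phi> by (auto simp: W_def)
        then show ?thesis by (simp add: V_def T_plus_iff)
      qed
      ultimately show "\<exists>U. openin (tau_K G \<tau>) U \<and> \<one>\<^bsub>G\<^esub> \<in> U \<and> (\<forall>\<phi>\<in>S. \<forall>x\<in>U. \<phi> x \<in> T_plus)"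
        by blast
    qed
  qed
  then show ?thesis using det unfolding L_def J_def by blast
qed

end
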